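(* Let $X$ be a Banach space with a given norm. The following are equivalent. (a) The dual norm on $X^*$ is $w^*$-Kadec. (b) Sequential Wijsman and slice convergence coincide in every separable subspace of $X$; that is, for every separable subspace $Y$ of $X$ and all closed convex sets $C_n, C\subset Y$ ($n\in\mathbb{N}$), the sequence $(C_n)$ converges Wijsman to $C$ in $Y$ if and only if it converges slice to $C$ in $Y$. (c) Wijsman and slice convergence coincide in every subspace of $X$; that is, for every subspace $Y$ of $X$ and every net $(C_\alpha)$ of closed convex subsets of $Y$ and closed convex $C\subset Y$, the net $(C_\alpha)$ converges Wijsman to $C$ in $Y$ if and only if it converges slice to $C$ in $Y$.
   Context: Banach spaces are real and $X$ is infinite dimensional. "Subspace" means closed linear subspace, endowed with the restriction of the given norm. For subsets $A,B$ of a normed space, $d(x,A)=\inf\{\|x-a\|:a\in A\}$ and $d(A,B)=\inf\{\|a-b\|:a\in A,b\in B\}$, with value $\infty$ if a set involved is empty. For closed convex subsets $C_\alpha$ (a net), $C$ of a Banach space $Y$: $C_\alpha$ converges Wijsman to $C$ in $Y$ if $\lim_\alpha d(y,C_\alpha)=d(y,C)$ for all $y\in Y$; $C_\alpha$ converges slice to $C$ in $Y$ if $\lim_\alpha d(W,C_\alpha)=d(W,C)$ for all closed bounded convex $W\subset Y$. The dual norm on $X^*$ is $w^*$-Kadec if $\|x_\alpha^*-x^*\|\to 0$ whenever $(x^*_\alpha)$ is a net in $X^*$ with $x_\alpha^*\to x^*$ in the weak$^*$ topology and $\|x_\alpha^*\|\to\|x^*\|$. *)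

theory Defs
  imports "HOL-Analysis.Analysis"
begin

section \<open>Distances\<close>

text \<open>
  Extended-real distances, with value \<open>\<infinity>\<close> as soon as a set involved is empty. The library
  functions \<open>infdist\<close> and \<open>setdist\<close> return \<open>0\<close> there, so they cannot be used.
\<close>

definition ext_infdist :: "'a::real_normed_vector \<Rightarrow> 'a set \<Rightarrow> ereal" where
  "ext_infdist x A = (INF a\<in>A. ereal (norm (x - a)))"

definition ext_setdist :: "'a::real_normed_vector set \<Rightarrow> 'a set \<Rightarrow> ereal" where
  "ext_setdist A B = (INF a\<in>A. INF b\<in>B. ereal (norm (a - b)))"

lemma ext_infdist_empty: "ext_infdist x {} = \<infinity>"
  by (simp add: ext_infdist_def top_ereal_def)

lemma ext_setdist_empty: "ext_setdist {} B = \<infinity>" "ext_setdist A {} = \<infinity>"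
  by (cases "A = {}"; simp add: ext_setdist_def top_ereal_def)+


section \<open>Nets\<close>

definition directed_set :: "'i set \<Rightarrow> ('i \<Rightarrow> 'i \<Rightarrow> bool) \<Rightarrow> bool" where
  "directed_set I le \<longleftrightarrow> I \<noteq> {} \<and> reflp_on I le \<and> transp_on I le \<and>
     (\<forall>i\<in>I. \<forall>j\<in>I. \<exists>k\<in>I. le i k \<and> le j k)"

text \<open>The limit of a net indexed by \<open>(I, le)\<close> is the limit along the filter of tails of \<open>(I, le)\<close>.\<close>

definition tails :: "'i set \<Rightarrow> ('i \<Rightarrow> 'i \<Rightarrow> bool) \<Rightarrow> 'i filter" where
  "tails I le = (INF i\<in>I. principal {j\<in>I. le i j})"

lemma eventually_tails:
  assumes "directed_set I le"
  shows "eventually P (tails I le) \<longleftrightarrow> (\<exists>i\<in>I. \<forall>j\<in>I. le i j \<longrightarrow> P j)"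
proof -
  have "eventually P (tails I le) \<longleftrightarrow> (\<exists>i\<in>I. eventually P (principal {j\<in>I. le i j}))"
    unfolding tails_def
  proof (rule eventually_INF_base)
    show "I \<noteq> {}"
      using assms by (simp add: directed_set_def)
  next
    fix i j assume ij: "i \<in> I" "j \<in> I"
    then obtain k where k: "k \<in> I" "le i k" "le j k"
      using assms unfolding directed_set_def by blast
    have "transp_on I le"
      using assms by (simp add: directed_set_def)
    then have "{l\<in>I. le k l} \<subseteq> {l\<in>I. le i l} \<inter> {l\<in>I. le j l}"
      using ij k by (blast dest: transp_onD)
    with k show "\<exists>k\<in>I. principal {l\<in>I. le k l}
        \<le> inf (principal {l\<in>I. le i l}) (principal {l\<in>I. le j l})"
      by auto
  qed
  then show ?thesis
    by (auto simp: eventually_principal)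
qed

lemma tails_neq_bot:
  assumes "directed_set I le"
  shows "tails I le \<noteq> bot"
  using assms unfolding trivial_limit_def eventually_tails[OF assms]
  by (auto simp: directed_set_def reflp_on_def)

text \<open>
  A formula cannot quantify over all index types. For nets with values in a type \<open>'b\<close>, however,
  the single index type \<open>'b net_index\<close> is as good as all of them: by \<open>net_reindex\<close> every net in a
  set \<open>S\<close>, over any index type, has the same image filter (hence the same limits) as a net in \<open>S\<close>
  indexed by a directed subset of \<open>'b net_index\<close>.
\<close>

type_synonym 'b net_index = "'b \<times> 'b set"

lemma filter_is_net:
  fixes F :: "'b filter"
  assumes "F \<noteq> bot" and S: "eventually (\<lambda>x. x \<in> S) F"
  obtains I :: "'b net_index set" and le and f :: "'b net_index \<Rightarrow> 'b"
  where "directed_set I le" "f ` I \<subseteq> S" "filtermap f (tails I le) = F"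
proof -
  define I where "I = {(x, E). x \<in> E \<and> E \<subseteq> S \<and> eventually (\<lambda>y. y \<in> E) F}"
  define le where "le = (\<lambda>(i :: 'b net_index) (j :: 'b net_index). snd j \<subseteq> snd i)"
  have I_ex: "\<exists>x. (x, E) \<in> I" if "E \<subseteq> S" "eventually (\<lambda>y. y \<in> E) F" for E
  proof -
    have "\<exists>x. x \<in> E"
      using eventually_happens[OF that(2)] assms(1) by (simp add: trivial_limit_def)
    with that show ?thesis
      by (auto simp: I_def)
  qed
  have dir: "directed_set I le"
    unfolding directed_set_def
  proof (intro conjI ballI)
    show "I \<noteq> {}"
      using I_ex[of S] S by auto
    show "reflp_on I le" "transp_on I le"
      by (auto simp: le_def reflp_on_def transp_on_def)
    fix i j assume "i \<in> I" "j \<in> I"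
    then have "snd i \<inter> snd j \<subseteq> S" "eventually (\<lambda>y. y \<in> snd i \<inter> snd j) F"
      by (auto simp: I_def intro: eventually_conj)
    from I_ex[OF this] obtain x where "(x, snd i \<inter> snd j) \<in> I" ..
    then show "\<exists>k\<in>I. le i k \<and> le j k"
      by (intro bexI) (auto simp: le_def)
  qed
  have "filtermap fst (tails I le) = F"
  proof (rule filter_eqI)
    fix P
    have "eventually P F" if ij: "i \<in> I" "\<forall>j\<in>I. le i j \<longrightarrow> P (fst j)" for i
    proof -
      have "eventually (\<lambda>y. y \<in> snd i) F" "snd i \<subseteq> S"
        using ij(1) by (auto simp: I_def)
      moreover have "P y" if "y \<in> snd i" for y
        using ij(2)[rule_format, of "(y, snd i)"] that calculation
        by (auto simp: I_def le_def)
      ultimately show ?thesis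
        by (auto elim: eventually_mono)
    qed
    moreover have "\<exists>i\<in>I. \<forall>j\<in>I. le i j \<longrightarrow> P (fst j)" if "eventually P F"
    proof -
      have "eventually (\<lambda>y. y \<in> {y\<in>S. P y}) F"
        using S that by (auto intro: eventually_conj)
      from I_ex[OF _ this] obtain x where "(x, {y\<in>S. P y}) \<in> I"
        by auto
      moreover have "P (fst j)" if "j \<in> I" "le (x, {y\<in>S. P y}) j" for j
        using that by (auto simp: I_def le_def)
      ultimately show ?thesis
        by blast
    qed
    ultimately show "eventually P (filtermap fst (tails I le)) = eventually P F"
      unfolding eventually_filtermap eventually_tails[OF dir] by blast
  qed
  moreover have "fst ` I \<subseteq> S"
    by (auto simp: I_def)
  ultimately show thesis
    using that dir by blast
qed

lemma net_reindex:
  fixes J :: "'i set" and g :: "'i \<Rightarrow> 'b"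
  assumes "directed_set J le'" "g ` J \<subseteq> S"
  obtains I :: "'b net_index set" and le and f :: "'b net_index \<Rightarrow> 'b"
  where "directed_set I le" "f ` I \<subseteq> S" "filtermap f (tails I le) = filtermap g (tails J le')"
proof (rule filter_is_net)
  show "filtermap g (tails J le') \<noteq> bot"
    using tails_neq_bot[OF assms(1)] by (simp add: filtermap_bot_iff)
  show "eventually (\<lambda>x. x \<in> S) (filtermap g (tails J le'))"
    using assms unfolding eventually_filtermap eventually_tails[OF assms(1)] directed_set_def
    by blast
qed (rule that)


section \<open>Wijsman and slice convergence\<close>

text \<open>
  \<open>Y\<close> is meant to be a closed linear subspace, so that being closed in \<open>Y\<close> and being closed in the
  whole space are the same thing for subsets of \<open>Y\<close>.
\<close>

definition closed_convex_in :: "'a::real_normed_vector set \<Rightarrow> 'a set \<Rightarrow> bool" where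
  "closed_convex_in Y C \<longleftrightarrow> C \<subseteq> Y \<and> closed C \<and> convex C"

definition wijsman_converges ::
    "'a::real_normed_vector set \<Rightarrow> ('i \<Rightarrow> 'a set) \<Rightarrow> 'a set \<Rightarrow> 'i filter \<Rightarrow> bool" where
  "wijsman_converges Y Cs C F \<longleftrightarrow>
     (\<forall>y\<in>Y. ((\<lambda>i. ext_infdist y (Cs i)) \<longlongrightarrow> ext_infdist y C) F)"

definition slice_converges ::
    "'a::real_normed_vector set \<Rightarrow> ('i \<Rightarrow> 'a set) \<Rightarrow> 'a set \<Rightarrow> 'i filter \<Rightarrow> bool" where
  "slice_converges Y Cs C F \<longleftrightarrow>
     (\<forall>W. closed_convex_in Y W \<and> bounded W \<longrightarrow>
        ((\<lambda>i. ext_setdist W (Cs i)) \<longlongrightarrow> ext_setdist W C) F)"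

lemma wijsman_converges_filtermap:
  "wijsman_converges Y id C (filtermap Cs F) \<longleftrightarrow> wijsman_converges Y Cs C F"
  by (simp add: wijsman_converges_def filterlim_filtermap)

lemma slice_converges_filtermap:
  "slice_converges Y id C (filtermap Cs F) \<longleftrightarrow> slice_converges Y Cs C F"
  by (simp add: slice_converges_def filterlim_filtermap)


definition wijsman_slice_coincide_seq :: "'a::real_normed_vector set \<Rightarrow> bool" where
  "wijsman_slice_coincide_seq Y \<longleftrightarrow>
     (\<forall>(Cs :: nat \<Rightarrow> 'a set) C.
        (\<forall>n. closed_convex_in Y (Cs n)) \<and> closed_convex_in Y C \<longrightarrow>
        (wijsman_converges Y Cs C sequentially \<longleftrightarrow> slice_converges Y Cs C sequentially))"

definition wijsman_slice_coincide_net :: "'a::real_normed_vector set \<Rightarrow> bool" where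
  "wijsman_slice_coincide_net Y \<longleftrightarrow>
     (\<forall>(I :: 'a set net_index set) le Cs C.
        directed_set I le \<and> (\<forall>i\<in>I. closed_convex_in Y (Cs i)) \<and> closed_convex_in Y C \<longrightarrow>
        (wijsman_converges Y Cs C (tails I le) \<longleftrightarrow> slice_converges Y Cs C (tails I le)))"

lemma wijsman_slice_coincide_net_any_index:
  fixes J :: "'i set" and Cs :: "'i \<Rightarrow> 'a::real_normed_vector set"
  assumes "wijsman_slice_coincide_net Y" "directed_set J le'"
    and "\<forall>j\<in>J. closed_convex_in Y (Cs j)" "closed_convex_in Y C"
  shows "wijsman_converges Y Cs C (tails J le') \<longleftrightarrow> slice_converges Y Cs C (tails J le')"
proof -
  have "Cs ` J \<subseteq> {D. closed_convex_in Y D}"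
    using assms(3) by blast
  then obtain I :: "'a set net_index set" and le f
    where dir: "directed_set I le" and f: "f ` I \<subseteq> {D. closed_convex_in Y D}"
      and eq: "filtermap f (tails I le) = filtermap Cs (tails J le')"
    by (rule net_reindex[OF assms(2)])
  have "\<forall>i\<in>I. closed_convex_in Y (f i)"
    using f by auto
  with dir have "wijsman_converges Y f C (tails I le) \<longleftrightarrow> slice_converges Y f C (tails I le)"
    using assms(1,4) by (simp add: wijsman_slice_coincide_net_def)
  then show ?thesis
    using wijsman_converges_filtermap[of Y C f "tails I le"]
      wijsman_converges_filtermap[of Y C Cs "tails J le'"]
      slice_converges_filtermap[of Y C f "tails I le"]
      slice_converges_filtermap[of Y C Cs "tails J le'"] by (simp add: eq)
qed


section \<open>The weak* Kadec property of the dual norm\<close>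

text \<open>
  The dual space is \<open>'a \<Rightarrow>\<^sub>L real\<close> with its operator norm. For real-valued operators, the strong
  operator topology, i.e. the topology of pointwise convergence, is the weak* topology.
\<close>

abbreviation weak_star_topology :: "('a::real_normed_vector \<Rightarrow>\<^sub>L real) topology" where
  "weak_star_topology \<equiv> strong_operator_topology"

lemma limitin_weak_star_iff:
  "limitin weak_star_topology f l F \<longleftrightarrow>
     (\<forall>x. ((\<lambda>i. blinfun_apply (f i) x) \<longlongrightarrow> blinfun_apply l x) F)"
proof
  assume L: "limitin weak_star_topology f l F"
  show "\<forall>x. ((\<lambda>i. blinfun_apply (f i) x) \<longlongrightarrow> blinfun_apply l x) F"
    using continuous_map_limit[OF strong_operator_topology_continuous_evaluation L]
    by (simp add: o_def)
next
  assume R: "\<forall>x. ((\<lambda>i. blinfun_apply (f i) x) \<longlongrightarrow> blinfun_apply l x) F"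
  have "limitin (product_topology (\<lambda>_. euclidean) UNIV)
      (\<lambda>i. blinfun_apply (f i)) (blinfun_apply l) F"
    using R by (simp add: limitin_componentwise)
  then have "limitin euclidean (\<lambda>i. blinfun_apply (f i)) (blinfun_apply l) F"
    by (simp add: euclidean_product_topology)
  then show "limitin weak_star_topology f l F"
    by (auto simp: limitin_def strong_operator_topology_def openin_pullback_topology
        topspace_pullback_topology)
qed

definition dual_norm_weak_star_kadec :: "'a::real_normed_vector itself \<Rightarrow> bool" where
  "dual_norm_weak_star_kadec _ \<longleftrightarrow>
     (\<forall>(I :: ('a \<Rightarrow>\<^sub>L real) net_index set) le f (l :: 'a \<Rightarrow>\<^sub>L real).
        directed_set I le \<and>
        limitin weak_star_topology f l (tails I le) \<and>
        ((\<lambda>i. norm (f i)) \<longlongrightarrow> norm l) (tails I le)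
        \<longrightarrow> ((\<lambda>i. norm (f i - l)) \<longlongrightarrow> 0) (tails I le))"

lemma dual_norm_weak_star_kadec_any_index:
  fixes J :: "'i set" and g :: "'i \<Rightarrow> 'a::real_normed_vector \<Rightarrow>\<^sub>L real"
  assumes "dual_norm_weak_star_kadec TYPE('a)" "directed_set J le'"
    and "limitin weak_star_topology g l (tails J le')"
    and "((\<lambda>j. norm (g j)) \<longlongrightarrow> norm l) (tails J le')"
  shows "((\<lambda>j. norm (g j - l)) \<longlongrightarrow> 0) (tails J le')"
proof -
  obtain I :: "('a \<Rightarrow>\<^sub>L real) net_index set" and le f
    where dir: "directed_set I le"
      and eq: "filtermap f (tails I le) = filtermap g (tails J le')"
    by (rule net_reindex[OF assms(2) subset_UNIV])
  have lim: "((\<lambda>i. h (f i)) \<longlongrightarrow> c) (tails I le) \<longleftrightarrow> ((\<lambda>j. h (g j)) \<longlongrightarrow> c) (tails J le')"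
    for h :: "('a \<Rightarrow>\<^sub>L real) \<Rightarrow> real" and c
    by (simp add: eq flip: filterlim_filtermap)
  have "limitin weak_star_topology f l (tails I le)"
    using assms(3) unfolding limitin_weak_star_iff
    by (simp add: lim[of "\<lambda>u. blinfun_apply u x" for x])
  moreover have "((\<lambda>i. norm (f i)) \<longlongrightarrow> norm l) (tails I le)"
    using assms(4) lim[of norm] by blast
  ultimately have "((\<lambda>i. norm (f i - l)) \<longlongrightarrow> 0) (tails I le)"
    using assms(1) dir unfolding dual_norm_weak_star_kadec_def by blast
  then show ?thesis
    using lim[of "\<lambda>u. norm (u - l)"] by blast
qed

end

theory Submission
  imports Defs
begin

text \<open>
  (a) to (c): Let \<open>C\<^sub>i\<close> converge Wijsman to \<open>C\<close> in \<open>Y\<close>, let \<open>W\<close> be bounded and put \<open>r = d(W, C) > 0\<close>. By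
  Hahn-Banach some \<open>\<phi>\<close> in the dual unit ball separates \<open>W\<close> and \<open>C\<close> with gap \<open>r\<close>, and then its
  restriction to \<open>Y\<close> has norm 1. Wijsman convergence yields \<open>\<psi>\<^sub>i\<close> in the dual unit ball, weak* close
  to \<open>\<phi>\<close> on \<open>Y\<close>, with \<open>sup \<psi>\<^sub>i(C\<^sub>i) \<le> sup \<phi>(C) + \<epsilon>\<close>. Since the Kadec property passes to \<open>Y\<close> by weak*
  compactness, \<open>\<psi>\<^sub>i\<close> is norm close to \<open>\<phi>\<close> on \<open>Y\<close>, so it separates \<open>W\<close> and \<open>C\<^sub>i\<close> with gap almost \<open>r\<close>.

  (b) to (a): If the Kadec property fails at \<open>l\<close>, one builds inductively a separable \<open>Y\<close> and functionals
  \<open>\<phi>\<^sub>n\<close> that converge to \<open>l\<close> weak* on \<open>Y\<close> and in norm value, but stay away from \<open>l\<close> in norm on \<open>Y\<close>. The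
  hyperplanes \<open>\<phi>\<^sub>n = 1\<close> of \<open>Y\<close> then converge Wijsman to \<open>l = 1\<close>, yet meet a bounded part of the kernel
  of \<open>l\<close>, which has positive distance to \<open>l = 1\<close>.
\<close>

section \<open>Sublinear functionals and the Mazur-Orlicz theorem\<close>

definition sublinear :: "('a::real_vector \<Rightarrow> real) \<Rightarrow> bool" where
  "sublinear p \<longleftrightarrow> (\<forall>x y. p (x + y) \<le> p x + p y) \<and> (\<forall>t x. 0 \<le> t \<longrightarrow> p (t *\<^sub>R x) = t * p x)"

lemma sublinear_add: "sublinear p \<Longrightarrow> p (x + y) \<le> p x + p y"
  by (simp add: sublinear_def)

lemma sublinear_scale: "sublinear p \<Longrightarrow> 0 \<le> t \<Longrightarrow> p (t *\<^sub>R x) = t * p x"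
  by (simp add: sublinear_def)

lemma sublinear_zero: "sublinear p \<Longrightarrow> p 0 = 0"
  using sublinear_scale[of p 0 0] by simp

lemma sublinear_neg_le: "sublinear p \<Longrightarrow> - p (- x) \<le> p x"
  using sublinear_add[of p x "- x"] sublinear_zero[of p] by simp

lemma sublinear_norm: "sublinear norm"
  by (simp add: sublinear_def norm_triangle_ineq)

text \<open>The scaling hypothesis, applied to \<open>inverse t\<close> and
  \<open>t *\<^sub>R x\<close>, yields the reverse inequality, so homogeneity may be checked as a
  one-sided estimate for positive \<open>t\<close>.\<close>

lemma sublinearI:
  assumes add: "\<And>x y. p (x + y) \<le> p x + p y"
    and zero: "p 0 = 0" and scale: "\<And>t x. 0 < t \<Longrightarrow> p (t *\<^sub>R x) \<le> t * p x"
  shows "sublinear p"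
  unfolding sublinear_def
proof (intro conjI allI impI)
  fix t :: real and x :: 'a
  assume t: "0 \<le> t"
  show "p (t *\<^sub>R x) = t * p x"
  proof (cases "t = 0")
    case False
    with t have t: "0 < t" by simp
    from scale[of "inverse t" "t *\<^sub>R x"] t have "t * p x \<le> p (t *\<^sub>R x)"
      by (simp add: field_simps)
    with scale[OF t] show ?thesis by (simp add: antisym)
  qed (simp add: zero)
qed (rule add)

text \<open>A pair \<open>(x, b)\<close> in \<open>D\<close> stands for the constraint \<open>b \<le> f x\<close>: every linear \<open>f \<le> q\<close> satisfies it, because
  \<open>- f x = f (- x) \<le> q (- x) \<le> - b\<close>.\<close>

lemma sublinear_below_constraints:
  assumes p: "sublinear p" and D: "convex D" "D \<noteq> {}"
    and le: "\<And>x b. (x, b) \<in> D \<Longrightarrow> b \<le> p x"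
  obtains q where "sublinear q" "q \<le> p" "\<And>x b. (x, b) \<in> D \<Longrightarrow> q (- x) \<le> - b"
proof -
  \<comment> \<open>Values of \<open>p\<close> at \<open>y\<close> shifted by nonnegative multiples
    of constraints, each credited with \<open>t * b\<close>; their infimum \<open>q\<close> is the
    auxiliary functional of the Mazur-Orlicz argument.\<close>
  define V where "V y = {p (y + t *\<^sub>R x) - t * b | t x b. 0 \<le> t \<and> (x, b) \<in> D}" for y
  define q where "q y = Inf (V y)" for y
  have ne: "V y \<noteq> {}" for y
    using D(2) unfolding V_def by force
  \<comment> \<open>A bound independent of \<open>t\<close>, \<open>x\<close> and \<open>b\<close>,
    which makes the infimum finite.\<close>
  have low: "- p (- y) \<le> v" if "v \<in> V y" for y v
  proof -
    from that obtain t x b where v: "v = p (y + t *\<^sub>R x) - t * b" "0 \<le> t" "(x, b) \<in> D"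
      by (auto simp: V_def)
    have "t * b \<le> p (t *\<^sub>R x)"
      using le[OF v(3)] v(2) by (simp add: sublinear_scale[OF p] mult_left_mono)
    also have "\<dots> \<le> p (y + t *\<^sub>R x) + p (- y)"
      using sublinear_add[OF p, of "y + t *\<^sub>R x" "- y"] by simp
    finally show ?thesis by (simp add: v(1))
  qed
  have bdd: "bdd_below (V y)" for y
    using low by (rule bdd_belowI)
  have q_le: "q y \<le> v" if "v \<in> V y" for y v
    unfolding q_def by (rule cInf_lower[OF that bdd])
  have q_ge: "c \<le> q y" if "\<And>v. v \<in> V y \<Longrightarrow> c \<le> v" for y c
    unfolding q_def by (rule cInf_greatest[OF ne that])
  have q_le_p: "q y \<le> p y" for y
  proof -
    obtain x b where "(x, b) \<in> D" using D(2) by auto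
    then have "p (y + 0 *\<^sub>R x) - 0 * b \<in> V y" unfolding V_def by blast
    from q_le[OF this] show ?thesis by simp
  qed
  have V_add: "q (y + z) \<le> v + w" if "v \<in> V y" "w \<in> V z" for v w y z
  proof -
    from that obtain s x b t x' b'
      where v: "v = p (y + s *\<^sub>R x) - s * b" "0 \<le> s" "(x, b) \<in> D"
        and w: "w = p (z + t *\<^sub>R x') - t * b'" "0 \<le> t" "(x', b') \<in> D"
      by (auto simp: V_def)
    show ?thesis
    proof (cases "s + t = 0")
      case True
      then have "s = 0" "t = 0" using v w by auto
      then show ?thesis
        using q_le_p[of "y + z"] sublinear_add[OF p, of y z] by (simp add: v w)
    next
      case False
      \<comment> \<open>Convexity of \<open>D\<close> merges the two constraints with multipliers
        \<open>s\<close> and \<open>t\<close> into the single constraint \<open>(X, B)\<close> with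
        multiplier \<open>s + t\<close>.\<close>
      define X where "X = (s / (s + t)) *\<^sub>R x + (t / (s + t)) *\<^sub>R x'"
      define B where "B = (s / (s + t)) * b + (t / (s + t)) * b'"
      have "(s / (s + t)) *\<^sub>R (x, b) + (t / (s + t)) *\<^sub>R (x', b') \<in> D"
        using False v w by (intro convexD[OF D(1)]) (auto simp flip: add_divide_distrib)
      then have "(X, B) \<in> D" by (simp add: X_def B_def)
      then have "q (y + z) \<le> p (y + z + (s + t) *\<^sub>R X) - (s + t) * B"
        using v w by (intro q_le) (force simp: V_def)
      also have "(s + t) *\<^sub>R X = s *\<^sub>R x + t *\<^sub>R x'"
        using False by (simp add: X_def scaleR_add_right)
      also have "(s + t) * B = s * b + t * b'"
        using False by (simp add: B_def distrib_left)
      also have "p (y + z + (s *\<^sub>R x + t *\<^sub>R x')) - (s * b + t * b') \<le> v + w"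
        using sublinear_add[OF p, of "y + s *\<^sub>R x" "z + t *\<^sub>R x'"]
        by (simp add: v w algebra_simps)
      finally show ?thesis .
    qed
  qed
  have "sublinear q"
  proof (rule sublinearI)
    fix y z
    have "q (y + z) - q z \<le> v" if "v \<in> V y" for v
    proof -
      have "q (y + z) - v \<le> q z"
        using V_add[OF that, of _ z] by (intro q_ge) (simp add: algebra_simps)
      then show ?thesis by simp
    qed
    then have "q (y + z) - q z \<le> q y" by (rule q_ge)
    then show "q (y + z) \<le> q y + q z" by simp
  next
    have "0 \<le> q 0"
      using low[of _ 0] sublinear_zero[OF p] by (intro q_ge) simp
    with q_le_p[of 0] sublinear_zero[OF p] show "q 0 = 0" by simp
  next
    fix s :: real and y assume s: "0 < s"
    have "q (s *\<^sub>R y) / s \<le> v" if vV: "v \<in> V y" for v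
    proof -
      from vV obtain t x b where v: "v = p (y + t *\<^sub>R x) - t * b" "0 \<le> t" "(x, b) \<in> D"
        by (auto simp: V_def)
      \<comment> \<open>Scaling by \<open>s\<close> turns an element of \<open>V y\<close> into one
        of \<open>V (s *\<^sub>R y)\<close> with multiplier \<open>s * t\<close>.\<close>
      have "s * v = p (s *\<^sub>R (y + t *\<^sub>R x)) - s * t * b"
        using sublinear_scale[OF p, of s "y + t *\<^sub>R x"] s by (simp add: v(1) right_diff_distrib)
      also have "\<dots> = p (s *\<^sub>R y + (s * t) *\<^sub>R x) - (s * t) * b"
        by (simp add: scaleR_add_right)
      also have "q (s *\<^sub>R y) \<le> \<dots>"
        using v s by (intro q_le) (force simp: V_def)
      finally show ?thesis using s by (simp add: field_simps)
    qed
    then have "q (s *\<^sub>R y) / s \<le> q y" by (rule q_ge)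
    then show "q (s *\<^sub>R y) \<le> s * q y" using s by (simp add: field_simps)
  qed
  moreover have "q (- x) \<le> - b" if "(x, b) \<in> D" for x b
  proof -
    \<comment> \<open>The multiplier \<open>t = 1\<close> at the point \<open>- x\<close> leaves
      \<open>p 0 - b\<close>.\<close>
    have "p (- x + 1 *\<^sub>R x) - 1 * b \<in> V (- x)"
      unfolding V_def using that zero_le_one by blast
    from q_le[OF this] show ?thesis by (simp add: sublinear_zero[OF p])
  qed
  ultimately show thesis
    using that q_le_p by (auto simp: le_fun_def)
qed

text \<open>Imposing the single constraint \<open>(x, p x)\<close> gives some
  \<open>q \<le> p\<close> with \<open>q (- x) \<le> - p x\<close>. Minimality forces
  \<open>q = p\<close>, so \<open>p\<close> is odd, and an odd subadditive function is
  additive.\<close>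

lemma linear_if_minimal_sublinear:
  assumes p: "sublinear p" and min: "\<And>q. sublinear q \<Longrightarrow> q \<le> p \<Longrightarrow> q = p"
  shows "linear p"
proof -
  have neg: "p (- x) = - p x" for x
  proof -
    obtain q where "sublinear q" "q \<le> p" "q (- x) \<le> - p x"
      by (rule sublinear_below_constraints[OF p, of "{(x, p x)}"]) auto
    with min have "p (- x) \<le> - p x" by blast
    with sublinear_neg_le[OF p, of x] show ?thesis by simp
  qed
  have add: "p (x + y) = p x + p y" for x y
    using sublinear_add[OF p, of x y] sublinear_add[OF p, of "x + y" "- y"] by (simp add: neg)
  have "p (t *\<^sub>R x) = t * p x" for t x
  proof (cases "0 \<le> t")
    case False
    then show ?thesis
      using sublinear_scale[OF p, of "- t" x] neg[of "t *\<^sub>R x"] by simp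
  qed (simp add: sublinear_scale[OF p])
  with add show ?thesis by (intro linearI) auto
qed

text \<open>Supplies the bounds for Zorn's lemma. The pointwise infimum is finite because every
  member lies above \<open>- p (- x)\<close>, and subadditive because the smaller of two members of
  the chain can replace both.\<close>

lemma sublinear_INF_chain:
  assumes ne: "C \<noteq> {}" and sub: "\<And>q. q \<in> C \<Longrightarrow> sublinear q"
    and le: "\<And>q. q \<in> C \<Longrightarrow> q \<le> p"
    and chain: "\<And>q r. q \<in> C \<Longrightarrow> r \<in> C \<Longrightarrow> q \<le> r \<or> r \<le> q"
  obtains m where "sublinear m" "\<And>q. q \<in> C \<Longrightarrow> m \<le> q"
proof -
  define m where "m x = (INF q\<in>C. q x)" for x
  have low: "- p (- x) \<le> q x" if "q \<in> C" for q x
    using sublinear_neg_le[OF sub[OF that], of x] le_funD[OF le[OF that], of "- x"] by linarith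
  have m_le: "m x \<le> q x" if "q \<in> C" for q x
    unfolding m_def using low that by (intro cINF_lower bdd_belowI2)
  have m_ge: "c \<le> m x" if "\<And>q. q \<in> C \<Longrightarrow> c \<le> q x" for c x
    unfolding m_def using ne that by (rule cINF_greatest)
  have "sublinear m"
  proof (rule sublinearI)
    fix x y
    have *: "m (x + y) \<le> q x + r y" if qr: "q \<in> C" "r \<in> C" for q r
    proof -
      obtain s where s: "s \<in> C" "s \<le> q" "s \<le> r"
        using chain[OF qr] qr by auto
      have "m (x + y) \<le> s x + s y"
        using m_le[OF s(1), of "x + y"] sublinear_add[OF sub[OF s(1)], of x y] by linarith
      also have "\<dots> \<le> q x + r y"
        using s by (simp add: le_fun_def add_mono)
      finally show ?thesis .
    qed
    have "m (x + y) - m y \<le> q x" if "q \<in> C" for q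
    proof -
      have "m (x + y) - q x \<le> m y"
        using *[OF that] by (intro m_ge) (simp add: algebra_simps)
      then show ?thesis by simp
    qed
    then have "m (x + y) - m y \<le> m x" by (rule m_ge)
    then show "m (x + y) \<le> m x + m y" by simp
  next
    show "m 0 = 0"
      using ne sub by (simp add: m_def sublinear_zero)
  next
    fix t :: real and x assume t: "0 < t"
    have "m (t *\<^sub>R x) / t \<le> q x" if "q \<in> C" for q
      using m_le[OF that, of "t *\<^sub>R x"] sublinear_scale[OF sub[OF that], of t x] t
      by (simp add: field_simps)
    then have "m (t *\<^sub>R x) / t \<le> m x" by (rule m_ge)
    then show "m (t *\<^sub>R x) \<le> t * m x" using t by (simp add: field_simps)
  qed
  with m_le that show thesis by (auto simp: le_fun_def)
qed

text \<open>Zorn's lemma yields a minimal sublinear functional below \<open>p\<close>, which is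
  linear by \<open>linear_if_minimal_sublinear\<close>.\<close>

lemma linear_below_sublinear:
  assumes p: "sublinear p"
  obtains f where "linear f" "f \<le> p"
proof -
  define A where "A = {q. sublinear q \<and> q \<le> p}"
  \<comment> \<open>The order is reversed, so that the maximal element from Zorn's lemma is a
    minimal functional.\<close>
  let ?R = "relation_of (\<lambda>q r. r \<le> q) A"
  have "\<exists>m\<in>A. \<forall>a\<in>A. a \<le> m \<longrightarrow> a = m"
  proof (rule predicate_Zorn)
    show "partial_order_on A ?R"
      by (auto simp: partial_order_on_def preorder_on_def refl_on_def trans_def antisym_def
          relation_of_def)
  next
    fix C assume C: "C \<in> Chains ?R"
    then have CA: "q \<in> A" if "q \<in> C" for q
      using that by (auto simp: Chains_def relation_of_def)
    show "\<exists>u\<in>A. \<forall>a\<in>C. u \<le> a"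
    proof (cases "C = {}")
      case True
      with p show ?thesis by (auto simp: A_def)
    next
      case False
      obtain m where "sublinear m" "\<And>q. q \<in> C \<Longrightarrow> m \<le> q"
      proof (rule sublinear_INF_chain[OF False])
        show "q \<le> r \<or> r \<le> q" if "q \<in> C" "r \<in> C" for q r
          using C that by (auto simp: Chains_def relation_of_def)
      qed (use CA in \<open>auto simp: A_def\<close>)
      with False CA show ?thesis
        by (intro bexI[of _ m]) (auto simp: A_def intro: order_trans)
    qed
  qed
  then obtain m where m: "m \<in> A" "\<forall>a\<in>A. a \<le> m \<longrightarrow> a = m" by blast
  have "linear m"
    using m by (intro linear_if_minimal_sublinear) (auto simp: A_def intro: order_trans)
  with m(1) that show thesis by (auto simp: A_def)
qed

text \<open>A linear \<open>f\<close> below the \<open>q\<close> of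
  \<open>sublinear_below_constraints\<close> satisfies every constraint, and
  \<open>f \<le> norm\<close> at both \<open>x\<close> and \<open>- x\<close> bounds its operator
  norm by 1.\<close>

lemma mazur_orlicz:
  fixes D :: "('a::real_normed_vector \<times> real) set"
  assumes D: "convex D" and le: "\<And>x b. (x, b) \<in> D \<Longrightarrow> b \<le> norm x"
  obtains f :: "'a \<Rightarrow>\<^sub>L real" where "norm f \<le> 1" "\<And>x b. (x, b) \<in> D \<Longrightarrow> b \<le> blinfun_apply f x"
proof (cases "D = {}")
  case True
  then show thesis using that[of 0] by simp
next
  case False
  obtain q where q: "sublinear q" "q \<le> norm" "\<And>x b. (x, b) \<in> D \<Longrightarrow> q (- x) \<le> - b"
    using sublinear_below_constraints[OF sublinear_norm D False le] by blast
  obtain f where f: "linear f" "f \<le> q"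
    using linear_below_sublinear[OF q(1)] .
  have f_le: "f x \<le> norm x" for x
    using f(2) q(2) by (meson le_funE order_trans)
  have bound: "norm (f x) \<le> norm x * 1" for x
    using f_le[of x] f_le[of "- x"] by (simp add: linear_neg[OF f(1)] abs_le_iff)
  have bl: "bounded_linear f"
    using linear_add[OF f(1)] linear_scale[OF f(1)] bound by (intro bounded_linear_intro[where K = 1]) auto
  show thesis
  proof (rule that)
    show "norm (Blinfun f) \<le> 1"
      using bound by (intro norm_blinfun_bound) (auto simp: bounded_linear_Blinfun_apply[OF bl])
    show "b \<le> blinfun_apply (Blinfun f) x" if "(x, b) \<in> D" for x b
      using q(3)[OF that] le_funD[OF f(2), of "- x"] linear_neg[OF f(1), of x]
      by (simp add: bounded_linear_Blinfun_apply[OF bl])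
  qed
qed


section \<open>The Kadec property on a subspace\<close>

text \<open>Tychonoff: the set is a product of compact intervals in the topology of pointwise
  convergence.\<close>

lemma compact_pointwise_bounded_functions:
  fixes r :: "'i \<Rightarrow> real"
  shows "compact {g. \<forall>x. \<bar>g x\<bar> \<le> r x}"
proof -
  have "{g. \<forall>x. \<bar>g x\<bar> \<le> r x} = PiE UNIV (\<lambda>x. {- r x..r x})"
    by (auto simp: PiE_def Pi_def abs_le_iff) (metis minus_le_iff)+
  moreover have "compactin (product_topology (\<lambda>_. euclidean) UNIV) (PiE UNIV (\<lambda>x. {- r x..r x}))"
    by (simp add: compactin_PiE)
  ultimately show ?thesis
    by (simp add: euclidean_product_topology)
qed

text \<open>Banach-Alaoglu for filters: a cluster point exists among the functions bounded by
  \<open>norm\<close>, and it is linear as a pointwise limit of linear functionals. The finer filter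
  \<open>H\<close> plays the part of a subnet.\<close>

lemma banach_alaoglu_filter:
  fixes G :: "('a::real_normed_vector \<Rightarrow>\<^sub>L real) filter"
  assumes G: "G \<noteq> bot" and norm_le: "eventually (\<lambda>\<psi>. norm \<psi> \<le> 1) G"
  obtains H and l :: "'a \<Rightarrow>\<^sub>L real"
  where "H \<le> G" "H \<noteq> bot" "norm l \<le> 1"
    "\<And>x. ((\<lambda>\<psi>. blinfun_apply \<psi> x) \<longlongrightarrow> blinfun_apply l x) H"
proof -
  let ?B = "{g :: 'a \<Rightarrow> real. \<forall>x. \<bar>g x\<bar> \<le> norm x}"
  let ?G = "filtermap blinfun_apply G"
  have "eventually (\<lambda>g. g \<in> ?B) ?G"
    unfolding eventually_filtermap
    using norm_le
  proof eventually_elim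
    case (elim \<psi>)
    show ?case
    proof (intro CollectI allI)
      fix x
      have "\<bar>blinfun_apply \<psi> x\<bar> \<le> norm \<psi> * norm x"
        using norm_blinfun[of \<psi> x] by simp
      also have "\<dots> \<le> norm x"
        using elim mult_right_mono[of "norm \<psi>" 1 "norm x"] by simp
      finally show "\<bar>blinfun_apply \<psi> x\<bar> \<le> norm x" .
    qed
  qed
  moreover have "?G \<noteq> bot"
    using G by (simp add: filtermap_bot_iff)
  ultimately obtain g where g: "g \<in> ?B" "inf (nhds g) ?G \<noteq> bot"
    using compact_pointwise_bounded_functions[of "norm :: 'a \<Rightarrow> real"]
    unfolding compact_filter by blast
  \<comment> \<open>Adds to \<open>G\<close> the preimages of the neighbourhoods of
    \<open>g\<close>; the result is nontrivial because \<open>g\<close> is a cluster point of the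
    image filter.\<close>
  define H where "H = inf (filtercomap blinfun_apply (nhds g)) G"
  have "H \<noteq> bot"
  proof
    assume "H = bot"
    then have "eventually (\<lambda>_. False) H" by simp
    then obtain P Q where PQ: "eventually P (nhds g)" "eventually Q G"
        "\<And>\<psi>. P (blinfun_apply \<psi>) \<Longrightarrow> Q \<psi> \<Longrightarrow> False"
      unfolding H_def eventually_inf eventually_filtercomap by blast
    have "eventually (\<lambda>f. \<not> P f) ?G"
      unfolding eventually_filtermap using PQ(2) by eventually_elim (use PQ(3) in blast)
    with PQ(1) have "eventually (\<lambda>_. False) (inf (nhds g) ?G)"
      unfolding eventually_inf by blast
    with g(2) show False by (simp add: trivial_limit_def)
  qed
  have lim: "((\<lambda>\<psi>. blinfun_apply \<psi> x) \<longlongrightarrow> g x) H" for x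
  proof -
    have "((\<lambda>f::'a \<Rightarrow> real. f x) \<longlongrightarrow> g x) (at g)"
      using continuous_on_product_coordinates[of x] unfolding continuous_on_def by blast
    then have "((\<lambda>f::'a \<Rightarrow> real. f x) \<longlongrightarrow> g x) (nhds g)"
      by (subst (asm) tendsto_at_iff_tendsto_nhds)
    moreover have "filterlim blinfun_apply (nhds g) H"
      unfolding H_def by (rule filterlim_mono[OF filterlim_filtercomap order_refl inf_le1])
    ultimately show ?thesis
      by (rule filterlim_compose)
  qed
  have "g (x + y) = g x + g y" for x y
    using tendsto_unique[OF \<open>H \<noteq> bot\<close> lim[of "x + y"]] tendsto_add[OF lim[of x] lim[of y]]
    by (simp add: blinfun.add_right)
  moreover have "g (t *\<^sub>R x) = t * g x" for t x
    using tendsto_unique[OF \<open>H \<noteq> bot\<close> lim[of "t *\<^sub>R x"]] tendsto_mult_left[OF lim[of x], of t]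
    by (simp add: blinfun.scaleR_right)
  ultimately have bl: "bounded_linear g"
    using g(1) by (intro bounded_linear_intro[where K = 1]) auto
  show thesis
  proof (rule that)
    show "H \<le> G" by (simp add: H_def)
    show "norm (Blinfun g) \<le> 1"
      using g(1) by (intro norm_blinfun_bound) (auto simp: bounded_linear_Blinfun_apply[OF bl])
    show "((\<lambda>\<psi>. blinfun_apply \<psi> x) \<longlongrightarrow> blinfun_apply (Blinfun g) x) H" for x
      using lim by (simp add: bounded_linear_Blinfun_apply[OF bl])
  qed fact
qed

text \<open>Every nontrivial filter is the image of the tails of some net, so the property passes
  from nets to filters; along \<open>bot\<close> everything converges.\<close>

lemma dual_norm_weak_star_kadec_filter:
  fixes G :: "('a::real_normed_vector \<Rightarrow>\<^sub>L real) filter"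
  assumes "dual_norm_weak_star_kadec TYPE('a)"
    and lim: "\<And>x. ((\<lambda>\<psi>. blinfun_apply \<psi> x) \<longlongrightarrow> blinfun_apply l x) G"
    and norm: "(norm \<longlongrightarrow> norm l) G"
  shows "((\<lambda>\<psi>. norm (\<psi> - l)) \<longlongrightarrow> 0) G"
proof (cases "G = bot")
  case False
  obtain I :: "('a \<Rightarrow>\<^sub>L real) net_index set" and le f
    where dir: "directed_set I le" and G: "filtermap f (tails I le) = G"
    by (rule filter_is_net[OF False, of UNIV]) auto
  have "((\<lambda>i. norm (f i - l)) \<longlongrightarrow> 0) (tails I le)"
  proof (rule dual_norm_weak_star_kadec_any_index[OF assms(1) dir])
    show "limitin weak_star_topology f l (tails I le)"
      using lim unfolding limitin_weak_star_iff G[symmetric] by (simp add: filterlim_filtermap)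
    show "((\<lambda>j. norm (f j)) \<longlongrightarrow> norm l) (tails I le)"
      using norm unfolding G[symmetric] by (simp add: filterlim_filtermap)
  qed
  then show ?thesis
    unfolding G[symmetric] by (simp add: filterlim_filtermap)
qed simp

lemma abs_blinfun_le:
  fixes \<psi> :: "'a::real_normed_vector \<Rightarrow>\<^sub>L real"
  assumes "norm \<psi> \<le> c"
  shows "\<bar>blinfun_apply \<psi> x\<bar> \<le> c * norm x"
  using norm_blinfun[of \<psi> x] mult_right_mono[OF assms, of "norm x"] by simp

text \<open>Weak* lower semicontinuity of the dual norm, witnessed by one vector of the unit
  ball.\<close>

lemma norm_blinfun_ge_limit:
  fixes l :: "'a::real_normed_vector \<Rightarrow>\<^sub>L real"
  assumes "((\<lambda>i. blinfun_apply (\<psi> i) x) \<longlongrightarrow> blinfun_apply l x) F" "norm x \<le> 1" "c < blinfun_apply l x"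
  shows "eventually (\<lambda>i. c < norm (\<psi> i)) F"
  using order_tendstoD(1)[OF assms(1,3)]
proof eventually_elim
  case (elim i)
  have "blinfun_apply (\<psi> i) x \<le> norm (\<psi> i)"
    using norm_blinfun[of "\<psi> i" x] mult_left_mono[OF assms(2) norm_ge_zero[of "\<psi> i"]] by simp
  with elim show ?case by simp
qed

text \<open>If every basic weak* neighbourhood contained a functional violating the estimate, such
  functionals would have a weak* cluster point \<open>l\<close> that agrees with
  \<open>\<phi>\<close> on \<open>Y\<close>. The norming hypothesis gives \<open>norm l = 1\<close>,
  hence convergence of the norms, and the Kadec property at \<open>l\<close> contradicts the
  violation. It is used at \<open>l\<close> because \<open>l\<close> and \<open>\<phi>\<close> may
  differ off \<open>Y\<close>.\<close>

lemma kadec_neighbourhood: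
  fixes \<phi> :: "'a::real_normed_vector \<Rightarrow>\<^sub>L real"
  assumes kadec: "dual_norm_weak_star_kadec TYPE('a)"
    and norming: "\<And>\<eta>. \<eta> < 1 \<Longrightarrow> \<exists>y\<in>Y. norm y \<le> 1 \<and> \<eta> < blinfun_apply \<phi> y"
    and \<delta>: "0 < \<delta>"
  obtains E \<epsilon> where "finite E" "E \<subseteq> Y" "0 < \<epsilon>"
    "\<And>\<psi> y. norm \<psi> \<le> 1 \<Longrightarrow> (\<And>x. x \<in> E \<Longrightarrow> \<bar>blinfun_apply \<psi> x - blinfun_apply \<phi> x\<bar> \<le> \<epsilon>) \<Longrightarrow> y \<in> Y \<Longrightarrow>
      \<bar>blinfun_apply \<psi> y - blinfun_apply \<phi> y\<bar> \<le> \<delta> * norm y"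
proof -
  \<comment> \<open>The functionals of the unit ball that lie in the neighbourhood of
    \<open>\<phi>\<close> given by \<open>E\<close> and \<open>\<epsilon>\<close> but violate the
    estimate on \<open>Y\<close>.\<close>
  define bad where "bad = (\<lambda>(E, \<epsilon>). {\<psi>. norm \<psi> \<le> 1 \<and>
    (\<forall>x\<in>E. \<bar>blinfun_apply \<psi> x - blinfun_apply \<phi> x\<bar> \<le> \<epsilon>) \<and>
    (\<exists>y\<in>Y. \<delta> * norm y < \<bar>blinfun_apply \<psi> y - blinfun_apply \<phi> y\<bar>)})"
  define J where "J = {(E, \<epsilon>). finite E \<and> E \<subseteq> Y \<and> (0::real) < \<epsilon>}"
  have "\<exists>p\<in>J. bad p = {}"
  proof (rule ccontr)
    assume none: "\<not> (\<exists>p\<in>J. bad p = {})"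
    define G where "G = (INF p\<in>J. principal (bad p))"
    have ev_G: "eventually P G \<longleftrightarrow> (\<exists>p\<in>J. eventually P (principal (bad p)))" for P
      unfolding G_def
    proof (rule eventually_INF_base)
      show "J \<noteq> {}" by (auto simp: J_def intro!: exI[of _ "{}"] exI[of _ 1])
      fix p q assume "p \<in> J" "q \<in> J"
      then show "\<exists>r\<in>J. principal (bad r) \<le> inf (principal (bad p)) (principal (bad q))"
        by (intro bexI[of _ "(fst p \<union> fst q, min (snd p) (snd q))"]) (auto simp: J_def bad_def)
    qed
    have "G \<noteq> bot"
      using none unfolding trivial_limit_def ev_G by (auto simp: eventually_principal)
    have ev_bad: "eventually (\<lambda>\<psi>. \<psi> \<in> bad p) G" if "p \<in> J" for p
      unfolding ev_G using that by (auto simp: eventually_principal)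
    \<comment> \<open>The pair \<open>({}, 1)\<close> tests no point and keeps only the norm bound
      and the violation.\<close>
    have "eventually (\<lambda>\<psi>. norm \<psi> \<le> 1) G"
      using ev_bad[of "({}, 1)"] by (auto simp: J_def bad_def elim: eventually_mono)
    then obtain H l where H: "H \<le> G" "H \<noteq> bot" "norm l \<le> 1"
      and lim: "\<And>x. ((\<lambda>\<psi>. blinfun_apply \<psi> x) \<longlongrightarrow> blinfun_apply l x) H"
      using banach_alaoglu_filter[OF \<open>G \<noteq> bot\<close>] by metis
    have ev_bad_H: "eventually (\<lambda>\<psi>. \<psi> \<in> bad p) H" if "p \<in> J" for p
      using ev_bad[OF that] H(1) by (rule filter_leD[rotated])
    have l_eq: "blinfun_apply l y = blinfun_apply \<phi> y" if y: "y \<in> Y" for y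
    proof -
      have "((\<lambda>\<psi>. blinfun_apply \<psi> y) \<longlongrightarrow> blinfun_apply \<phi> y) H"
      proof (rule tendstoI)
        fix e :: real assume "0 < e"
        then have "eventually (\<lambda>\<psi>. \<psi> \<in> bad ({y}, e / 2)) H"
          using y by (intro ev_bad_H) (auto simp: J_def)
        then show "eventually (\<lambda>\<psi>. dist (blinfun_apply \<psi> y) (blinfun_apply \<phi> y) < e) H"
          by eventually_elim (use \<open>0 < e\<close> in \<open>auto simp: bad_def dist_real_def\<close>)
      qed
      from tendsto_unique[OF H(2) lim this] show ?thesis .
    qed
    \<comment> \<open>The bound by 1 survives the limit; \<open>norming\<close> gives the other half
      because \<open>l\<close> and \<open>\<phi>\<close> agree on \<open>Y\<close>.\<close>
    have norm_l: "norm l = 1"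
    proof (rule antisym[OF H(3)], rule ccontr)
      assume "\<not> 1 \<le> norm l"
      then obtain y where "y \<in> Y" "norm y \<le> 1" "norm l < blinfun_apply \<phi> y"
        using norming[of "norm l"] by auto
      moreover from this have "\<bar>blinfun_apply l y\<bar> \<le> norm l"
        using norm_blinfun[of l y] mult_left_mono[of "norm y" 1 "norm l"] by simp
      ultimately show False using l_eq by auto
    qed
    have "(norm \<longlongrightarrow> norm l) H"
    proof (rule order_tendstoI)
      fix a assume "a < norm l"
      then obtain y where y: "y \<in> Y" "norm y \<le> 1" "a < blinfun_apply \<phi> y"
        using norming[of a] norm_l by auto
      show "eventually (\<lambda>\<psi>. a < norm \<psi>) H"
        using norm_blinfun_ge_limit[OF lim y(2)] y l_eq by simp
    next
      fix a assume "norm l < a"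
      then show "eventually (\<lambda>\<psi>. norm \<psi> < a) H"
        using ev_bad_H[of "({}, 1)"] norm_l by (auto simp: J_def bad_def elim: eventually_mono)
    qed
    then have "((\<lambda>\<psi>. norm (\<psi> - l)) \<longlongrightarrow> 0) H"
      using dual_norm_weak_star_kadec_filter[OF kadec lim] by blast
    then have "eventually (\<lambda>\<psi>. norm (\<psi> - l) < \<delta>) H"
      using \<delta> by (rule order_tendstoD(2))
    moreover have "eventually (\<lambda>\<psi>. \<psi> \<in> bad ({}, 1)) H"
      by (rule ev_bad_H) (auto simp: J_def)
    ultimately have "eventually (\<lambda>_. False) H"
    proof eventually_elim
      case (elim \<psi>)
      then obtain y where y: "y \<in> Y" "\<delta> * norm y < \<bar>blinfun_apply \<psi> y - blinfun_apply \<phi> y\<bar>"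
        by (auto simp: bad_def)
      have "\<bar>blinfun_apply (\<psi> - l) y\<bar> \<le> \<delta> * norm y"
        using elim(1) by (intro abs_blinfun_le) simp
      with y l_eq show False by (simp add: blinfun.diff_left)
    qed
    with H(2) show False by (simp add: trivial_limit_def)
  qed
  then obtain E \<epsilon> where "(E, \<epsilon>) \<in> J" "bad (E, \<epsilon>) = {}" by auto
  then show thesis
    using that[of E \<epsilon>] unfolding J_def bad_def by (auto simp: not_less)
qed


section \<open>From the Kadec property to slice convergence\<close>

lemma le_ext_infdist_iff: "e \<le> ext_infdist x A \<longleftrightarrow> (\<forall>a\<in>A. e \<le> ereal (norm (x - a)))"
  by (simp add: ext_infdist_def le_INF_iff)

lemma ext_infdist_less_iff: "ext_infdist x A < e \<longleftrightarrow> (\<exists>a\<in>A. ereal (norm (x - a)) < e)"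
  by (simp add: ext_infdist_def INF_less_iff)

lemma le_ext_setdist_iff: "e \<le> ext_setdist A B \<longleftrightarrow> (\<forall>a\<in>A. \<forall>b\<in>B. e \<le> ereal (norm (a - b)))"
  by (simp add: ext_setdist_def le_INF_iff)

lemma ext_setdist_less_iff: "ext_setdist A B < e \<longleftrightarrow> (\<exists>a\<in>A. \<exists>b\<in>B. ereal (norm (a - b)) < e)"
  by (simp add: ext_setdist_def INF_less_iff)


lemma ext_setdist_eq_setdist:
  assumes "A \<noteq> {}" "B \<noteq> {}"
  shows "ext_setdist A B = ereal (setdist A B)"
proof (rule antisym)
  show "ereal (setdist A B) \<le> ext_setdist A B"
    by (auto simp: le_ext_setdist_iff setdist_le_dist simp flip: dist_norm)
  obtain a b where ab: "a \<in> A" "b \<in> B" using assms by auto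
  have "0 \<le> ext_setdist A B" by (simp add: le_ext_setdist_iff)
  moreover have "ext_setdist A B \<le> ereal (norm (a - b))"
    using le_ext_setdist_iff[of "ext_setdist A B" A B] ab by blast
  ultimately obtain r where r: "ext_setdist A B = ereal r"
    by (cases "ext_setdist A B") auto
  have "r \<le> setdist A B"
    using assms le_ext_setdist_iff[of "ereal r" A B]
    by (intro le_setdistI) (auto simp: r dist_norm)
  with r show "ext_setdist A B \<le> ereal (setdist A B)" by simp
qed

text \<open>A singleton is a bounded closed convex test set, and its distance to a set is the
  distance of its point.\<close>

lemma slice_converges_imp_wijsman:
  assumes "slice_converges Y Cs C F"
  shows "wijsman_converges Y Cs C F"
proof -
  have "ext_setdist {y} A = ext_infdist y A" for y :: 'a and A
    by (simp add: ext_setdist_def ext_infdist_def)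
  moreover have "((\<lambda>i. ext_setdist {y} (Cs i)) \<longlongrightarrow> ext_setdist {y} C) F" if "y \<in> Y" for y
    using assms that unfolding slice_converges_def by (simp add: closed_convex_in_def)
  ultimately show ?thesis
    by (simp add: wijsman_converges_def)
qed

text \<open>Distance functions and \<open>h\<close> are 1-Lipschitz, so convergence at the points of
  a finite \<open>\<epsilon> / 3\<close>-net controls all of \<open>K\<close>: one third is spent on
  convergence, the other two on moving to a net point in \<open>h\<close> and in the norm.\<close>

lemma eventually_uniform_lower_bound:
  fixes h :: "'a::real_normed_vector \<Rightarrow> real"
  assumes K: "compact K" "K \<subseteq> Y" and w: "wijsman_converges Y Cs C F"
    and lip: "\<And>x y. \<bar>h x - h y\<bar> \<le> norm (x - y)"
    and le: "\<And>y c. y \<in> K \<Longrightarrow> c \<in> C \<Longrightarrow> h y \<le> norm (y - c)"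
    and \<epsilon>: "0 < \<epsilon>"
  shows "eventually (\<lambda>i. \<forall>y\<in>K. \<forall>c\<in>Cs i. h y - \<epsilon> \<le> norm (y - c)) F"
proof -
  obtain N where N: "finite N" "N \<subseteq> K" "K \<subseteq> (\<Union>x\<in>N. ball x (\<epsilon> / 3))"
    using seq_compact_imp_totally_bounded[of K] K(1) \<epsilon>
    by (metis compact_imp_seq_compact divide_pos_pos zero_less_numeral)
  have "eventually (\<lambda>i. \<forall>c\<in>Cs i. h y - \<epsilon> / 3 \<le> norm (y - c)) F" if y: "y \<in> N" for y
  proof -
    have "((\<lambda>i. ext_infdist y (Cs i)) \<longlongrightarrow> ext_infdist y C) F"
      using w y N(2) K(2) unfolding wijsman_converges_def by blast
    moreover have "ereal (h y - \<epsilon> / 3) < ext_infdist y C"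
    proof -
      have "ereal (h y - \<epsilon> / 3) < ereal (h y)" using \<epsilon> by simp
      also have "\<dots> \<le> ext_infdist y C"
        using le y N(2) by (auto simp: le_ext_infdist_iff)
      finally show ?thesis .
    qed
    ultimately have "eventually (\<lambda>i. ereal (h y - \<epsilon> / 3) < ext_infdist y (Cs i)) F"
      by (rule order_tendstoD(1))
    then show ?thesis
    proof eventually_elim
      case (elim i)
      then have "ereal (h y - \<epsilon> / 3) \<le> ext_infdist y (Cs i)" by (rule less_imp_le)
      then show ?case unfolding le_ext_infdist_iff by simp
    qed
  qed
  then have "eventually (\<lambda>i. \<forall>y\<in>N. \<forall>c\<in>Cs i. h y - \<epsilon> / 3 \<le> norm (y - c)) F"
    using N(1) by (simp add: eventually_ball_finite_distrib)
  then show ?thesis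
  proof eventually_elim
    case (elim i)
    show ?case
    proof (intro ballI)
      fix y c assume "y \<in> K" "c \<in> Cs i"
      then obtain x where x: "x \<in> N" "norm (x - y) < \<epsilon> / 3"
        using N(3) by (auto simp: dist_norm)
      have "h x - \<epsilon> / 3 \<le> norm (x - c)" using elim x \<open>c \<in> Cs i\<close> by blast
      moreover have "norm (x - c) \<le> norm (x - y) + norm (y - c)"
        using norm_triangle_ineq[of "x - y" "y - c"] by simp
      ultimately show "h y - \<epsilon> \<le> norm (y - c)"
        using lip[of x y] x(2) by linarith
    qed
  qed
qed

text \<open>These constraints bundle \<open>\<phi> z - \<epsilon> \<le> f z\<close> for \<open>z \<in> K\<close> (\<open>\<tau> = 0\<close>) with \<open>f c \<le> s + \<epsilon>\<close> for \<open>c \<in> C\<close>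
  (\<open>z = 0\<close>, \<open>\<tau> = 1\<close>) into one convex set, as the Mazur-Orlicz theorem needs.\<close>

lemma convex_approximation_constraints:
  assumes K: "convex K" and C: "convex C"
  shows "convex {(z - \<tau> *\<^sub>R c, blinfun_apply \<phi> z - \<tau> * s - \<epsilon>) |z \<tau> c.
    z \<in> K \<and> 0 \<le> \<tau> \<and> \<tau> \<le> 1 \<and> c \<in> C}" (is "convex ?D")
proof (rule convexI)
  fix p q :: "'a \<times> real" and u v :: real
  assume p: "p \<in> ?D" and q: "q \<in> ?D" and uv: "0 \<le> u" "0 \<le> v" "u + v = 1"
  from p obtain z \<tau> c where p: "p = (z - \<tau> *\<^sub>R c, blinfun_apply \<phi> z - \<tau> * s - \<epsilon>)"
    "z \<in> K" "0 \<le> \<tau>" "\<tau> \<le> 1" "c \<in> C" by blast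
  from q obtain z' \<tau>' c' where q: "q = (z' - \<tau>' *\<^sub>R c', blinfun_apply \<phi> z' - \<tau>' * s - \<epsilon>)"
    "z' \<in> K" "0 \<le> \<tau>'" "\<tau>' \<le> 1" "c' \<in> C" by blast
  let ?z = "u *\<^sub>R z + v *\<^sub>R z'" and ?\<tau> = "u * \<tau> + v * \<tau>'"
  have z: "?z \<in> K" using K p q uv by (auto intro: convexD)
  have \<tau>: "0 \<le> ?\<tau>" "?\<tau> \<le> 1"
    using p q uv by (auto intro: convex_bound_le)
  obtain d where d: "d \<in> C" "?\<tau> *\<^sub>R d = (u * \<tau>) *\<^sub>R c + (v * \<tau>') *\<^sub>R c'"
  proof (cases "?\<tau> = 0")
    case True
    then have "u * \<tau> = 0" "v * \<tau>' = 0"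
      using p q uv by (simp_all add: add_nonneg_eq_0_iff)
    with that[OF p(5)] show ?thesis by simp
  next
    case False
    show ?thesis
    proof (rule that)
      show "(u * \<tau> / ?\<tau>) *\<^sub>R c + (v * \<tau>' / ?\<tau>) *\<^sub>R c' \<in> C"
        using False p q uv by (intro convexD[OF C]) (auto simp flip: add_divide_distrib)
    qed (use False in \<open>simp add: scaleR_add_right\<close>)
  qed
  have "u *\<^sub>R p + v *\<^sub>R q = (?z - ?\<tau> *\<^sub>R d, blinfun_apply \<phi> ?z - ?\<tau> * s - \<epsilon>)"
  proof -
    have "\<epsilon> = u * \<epsilon> + v * \<epsilon>" using uv by (simp flip: distrib_right)
    then have "u * (blinfun_apply \<phi> z - \<tau> * s - \<epsilon>) + v * (blinfun_apply \<phi> z' - \<tau>' * s - \<epsilon>)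
        = blinfun_apply \<phi> ?z - ?\<tau> * s - \<epsilon>"
      by (simp add: blinfun.add_right blinfun.scaleR_right algebra_simps)
    moreover have "u *\<^sub>R (z - \<tau> *\<^sub>R c) + v *\<^sub>R (z' - \<tau>' *\<^sub>R c') = ?z - ?\<tau> *\<^sub>R d"
      unfolding d(2) by (simp add: scaleR_diff_right)
    ultimately show ?thesis by (simp add: p(1) q(1))
  qed
  with z \<tau> d(1) show "u *\<^sub>R p + v *\<^sub>R q \<in> ?D" by blast
qed

text \<open>By the Mazur-Orlicz theorem it suffices that \<open>\<phi> z - \<tau> * s - \<epsilon>
  \<le> norm (z - \<tau> *\<^sub>R c)\<close> for \<open>z\<close> in a compact convex
  \<open>K\<close> containing \<open>E\<close>, for \<open>0 \<le> \<tau> \<le> 1\<close> and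
  \<open>c\<close> in \<open>Cs i\<close>. Division by \<open>\<tau>\<close> makes this a lower
  bound on the distance from \<open>inverse \<tau> *\<^sub>R z\<close> to \<open>Cs i\<close>. For
  \<open>\<tau> \<ge> \<sigma>\<close> these points fill the compact set \<open>L\<close>, on which
  Wijsman convergence is uniform.\<close>

lemma eventually_approximate_functional:
  fixes \<phi> :: "'a::real_normed_vector \<Rightarrow>\<^sub>L real"
  assumes w: "wijsman_converges Y Cs C F" and Y: "subspace Y"
    and convex: "eventually (\<lambda>i. convex (Cs i)) F"
    and \<phi>: "norm \<phi> \<le> 1" "\<And>c. c \<in> C \<Longrightarrow> blinfun_apply \<phi> c \<le> s"
    and C: "C \<noteq> {}" and E: "finite E" "E \<subseteq> Y" and \<epsilon>: "0 < \<epsilon>"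
  shows "eventually (\<lambda>i. \<exists>\<psi> :: 'a \<Rightarrow>\<^sub>L real. norm \<psi> \<le> 1 \<and>
    (\<forall>x\<in>E. \<bar>blinfun_apply \<psi> x - blinfun_apply \<phi> x\<bar> \<le> \<epsilon>) \<and>
    (\<forall>c\<in>Cs i. blinfun_apply \<psi> c \<le> s + \<epsilon>)) F"
proof -
  \<comment> \<open>The points \<open>- x\<close> make the estimate on \<open>E\<close> two-sided,
    and 0 isolates the bound on \<open>Cs i\<close>.\<close>
  define K where "K = convex hull (insert 0 (E \<union> uminus ` E))"
  have K: "compact K" "convex K"
    using E(1) by (auto simp: K_def intro: finite_imp_compact_convex_hull)
  have K_mem: "0 \<in> K" "\<And>x. x \<in> E \<Longrightarrow> x \<in> K" "\<And>x. x \<in> E \<Longrightarrow> - x \<in> K"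
    unfolding K_def by (auto intro!: hull_inc)
  have KY: "K \<subseteq> Y"
    unfolding K_def using E(2) Y
    by (intro hull_minimal) (auto simp: subspace_0 subspace_neg intro: subspace_imp_convex)
  from C obtain c\<^sub>0 where c0: "c\<^sub>0 \<in> C" by blast
  \<comment> \<open>Since \<open>c\<^sub>0\<close> lies in \<open>C\<close>, eventually
    \<open>Cs i\<close> meets the open ball of radius \<open>M\<close> around 0.\<close>
  define M where "M = norm c\<^sub>0 + 1"
  have M: "0 < M" by (simp add: M_def add_nonneg_pos)
  have "((\<lambda>i. ext_infdist 0 (Cs i)) \<longlongrightarrow> ext_infdist 0 C) F"
    using w subspace_0[OF Y] by (simp add: wijsman_converges_def)
  moreover have "ext_infdist 0 C < ereal M"
    unfolding ext_infdist_less_iff using c0 by (intro bexI[of _ c\<^sub>0]) (auto simp: M_def)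
  ultimately have "eventually (\<lambda>i. ext_infdist 0 (Cs i) < ereal M) F"
    by (rule order_tendstoD(2))
  then have near: "eventually (\<lambda>i. \<exists>c\<in>Cs i. norm c < M) F"
    by (simp add: ext_infdist_less_iff)
  \<comment> \<open>Chosen so that replacing a smaller \<open>\<tau>\<close> by
    \<open>\<sigma>\<close> costs at most \<open>\<epsilon> / 2\<close>; see
    \<open>\<sigma>_small\<close>.\<close>
  define \<sigma> where "\<sigma> = min 1 (\<epsilon> / (2 * (M + \<bar>s\<bar>)))"
  have \<sigma>: "0 < \<sigma>" "\<sigma> \<le> 1"
    using M \<epsilon> by (auto simp: \<sigma>_def intro!: divide_pos_pos)
  have "\<sigma> * (2 * (M + \<bar>s\<bar>)) \<le> \<epsilon> / (2 * (M + \<bar>s\<bar>)) * (2 * (M + \<bar>s\<bar>))"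
    using M by (intro mult_right_mono) (auto simp: \<sigma>_def)
  also have "\<dots> = \<epsilon>" using M by simp
  finally have \<sigma>_small: "\<sigma> * (M + \<bar>s\<bar>) \<le> \<epsilon> / 2" by (simp add: algebra_simps)
  define L where "L = (\<lambda>(\<tau>, z). inverse \<tau> *\<^sub>R z) ` ({\<sigma>..1} \<times> K)"
  have L: "compact L"
    unfolding L_def
  proof (rule compact_continuous_image)
    show "continuous_on ({\<sigma>..1} \<times> K) (\<lambda>(\<tau>, z). inverse \<tau> *\<^sub>R z)"
      unfolding case_prod_beta using \<sigma> by (intro continuous_intros) auto
  qed (intro compact_Times K compact_Icc)
  have LY: "L \<subseteq> Y"
    using KY Y by (auto simp: L_def intro: subspace_scale)
  \<comment> \<open>\<open>\<phi> y - s\<close> is a 1-Lipschitz minorant of the distance from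
    \<open>y\<close> to \<open>C\<close>, because \<open>\<phi> \<le> s\<close> on \<open>C\<close>
    and \<open>norm \<phi> \<le> 1\<close>.\<close>
  have "eventually (\<lambda>i. \<forall>y\<in>L. \<forall>c\<in>Cs i. (blinfun_apply \<phi> y - s) - \<epsilon> / 2 \<le> norm (y - c)) F"
  proof (rule eventually_uniform_lower_bound[OF L LY w])
    show "\<bar>(blinfun_apply \<phi> x - s) - (blinfun_apply \<phi> y - s)\<bar> \<le> norm (x - y)" for x y
      using abs_blinfun_le[OF \<phi>(1), of "x - y"] by (simp add: blinfun.diff_right)
    show "blinfun_apply \<phi> y - s \<le> norm (y - c)" if "c \<in> C" for y c
      using abs_blinfun_le[OF \<phi>(1), of "y - c"] \<phi>(2)[OF that] by (simp add: blinfun.diff_right)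
  qed (use \<epsilon> in simp)
  with near convex show ?thesis
  proof eventually_elim
    case (elim i)
    then obtain a where a: "a \<in> Cs i" "norm a < M" by blast
    have far: "blinfun_apply \<phi> z - \<tau> * s - \<tau> * (\<epsilon> / 2) \<le> norm (z - \<tau> *\<^sub>R c)"
      if "z \<in> K" "\<sigma> \<le> \<tau>" "\<tau> \<le> 1" "c \<in> Cs i" for z \<tau> c
    proof -
      have \<tau>: "0 < \<tau>" using that \<sigma> by simp
      have "inverse \<tau> *\<^sub>R z \<in> L" using that by (force simp: L_def)
      with elim(3) that have "blinfun_apply \<phi> (inverse \<tau> *\<^sub>R z) - s - \<epsilon> / 2 \<le> norm (inverse \<tau> *\<^sub>R z - c)"
        by blast
      then have "\<tau> * (blinfun_apply \<phi> (inverse \<tau> *\<^sub>R z) - s - \<epsilon> / 2) \<le> \<tau> * norm (inverse \<tau> *\<^sub>R z - c)"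
        using \<tau> by (intro mult_left_mono) auto
      also have "\<tau> * norm (inverse \<tau> *\<^sub>R z - c) = norm (\<tau> *\<^sub>R (inverse \<tau> *\<^sub>R z - c))"
        using \<tau> by simp
      also have "\<tau> *\<^sub>R (inverse \<tau> *\<^sub>R z - c) = z - \<tau> *\<^sub>R c"
        using \<tau> by (simp add: scaleR_diff_right)
      finally show ?thesis
        using \<tau> by (simp add: blinfun.scaleR_right right_diff_distrib mult.assoc[symmetric])
    qed
    have bound: "blinfun_apply \<phi> z - \<tau> * s - \<epsilon> \<le> norm (z - \<tau> *\<^sub>R c)"
      if "z \<in> K" "0 \<le> \<tau>" "\<tau> \<le> 1" "c \<in> Cs i" for z \<tau> c
    proof (cases "\<sigma> \<le> \<tau>")
      case True
      have "\<tau> * (\<epsilon> / 2) \<le> 1 * \<epsilon>" using that \<epsilon> by (intro mult_mono) auto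
      with far[OF that(1) True that(3,4)] show ?thesis by simp
    next
      \<comment> \<open>\<open>z / \<tau>\<close> leaves every compact set as \<open>\<tau>\<close> tends to 0, so \<open>c\<close> is moved towards the bounded point \<open>a\<close>.\<close>
      case False
      define d where "d = (1 - \<tau> / \<sigma>) *\<^sub>R a + (\<tau> / \<sigma>) *\<^sub>R c"
      have "d \<in> Cs i"
        unfolding d_def using elim(2) a(1) that False \<sigma> by (intro convexD) auto
      from far[OF that(1) order_refl \<sigma>(2) this]
      have 1: "blinfun_apply \<phi> z - \<sigma> * s - \<sigma> * (\<epsilon> / 2) \<le> norm (z - \<sigma> *\<^sub>R d)" .
      have "\<sigma> *\<^sub>R d = (\<sigma> - \<tau>) *\<^sub>R a + \<tau> *\<^sub>R c"
        using \<sigma> by (simp add: d_def scaleR_add_right right_diff_distrib)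
      then have eq: "z - \<sigma> *\<^sub>R d = (z - \<tau> *\<^sub>R c) - (\<sigma> - \<tau>) *\<^sub>R a" by simp
      have "norm (z - \<sigma> *\<^sub>R d) \<le> norm (z - \<tau> *\<^sub>R c) + (\<sigma> - \<tau>) * norm a"
        unfolding eq using norm_triangle_ineq4[of "z - \<tau> *\<^sub>R c" "(\<sigma> - \<tau>) *\<^sub>R a"] False by simp
      \<comment> \<open>The cost of passing from \<open>\<tau>\<close> to \<open>\<sigma>\<close>:
        the displacement by \<open>(\<sigma> - \<tau>) *\<^sub>R a\<close> and the change in the
        multiple of \<open>s\<close>.\<close>
      moreover have "(\<sigma> - \<tau>) * norm a + (\<sigma> - \<tau>) * s \<le> \<sigma> * (M + \<bar>s\<bar>)"
      proof -
        have "(\<sigma> - \<tau>) * (norm a + s) \<le> (\<sigma> - \<tau>) * (M + \<bar>s\<bar>)"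
          using a False by (intro mult_left_mono) auto
        also have "\<dots> \<le> \<sigma> * (M + \<bar>s\<bar>)"
          using that M by (intro mult_right_mono) auto
        finally show ?thesis by (simp add: distrib_left)
      qed
      moreover have "\<sigma> * (\<epsilon> / 2) \<le> 1 * (\<epsilon> / 2)"
        using \<sigma> \<epsilon> by (intro mult_right_mono) auto
      ultimately show ?thesis
        using 1 \<sigma>_small by (simp add: left_diff_distrib)
    qed
    define D where "D = {(z - \<tau> *\<^sub>R c, blinfun_apply \<phi> z - \<tau> * s - \<epsilon>) |z \<tau> c.
      z \<in> K \<and> 0 \<le> \<tau> \<and> \<tau> \<le> 1 \<and> c \<in> Cs i}"
    have memD: "(z - \<tau> *\<^sub>R c, blinfun_apply \<phi> z - \<tau> * s - \<epsilon>) \<in> D"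
      if "z \<in> K" "0 \<le> \<tau>" "\<tau> \<le> 1" "c \<in> Cs i" for z \<tau> c
      using that unfolding D_def by blast
    have "convex D"
      unfolding D_def using K(2) elim(2) by (rule convex_approximation_constraints)
    moreover have "b \<le> norm x" if "(x, b) \<in> D" for x b
      using that bound unfolding D_def by blast
    ultimately obtain \<psi> :: "'a \<Rightarrow>\<^sub>L real"
      where \<psi>: "norm \<psi> \<le> 1" "\<And>x b. (x, b) \<in> D \<Longrightarrow> b \<le> blinfun_apply \<psi> x"
      using mazur_orlicz[of D] by blast
    have "blinfun_apply \<phi> z - \<epsilon> \<le> blinfun_apply \<psi> z" if "z \<in> K" for z
      using \<psi>(2)[OF memD[OF that order_refl zero_le_one a(1)]] by simp
    from this[OF K_mem(2)] this[OF K_mem(3)]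
    have "\<bar>blinfun_apply \<psi> x - blinfun_apply \<phi> x\<bar> \<le> \<epsilon>" if "x \<in> E" for x
      using that by (force simp: blinfun.minus_right abs_le_iff)
    moreover have "blinfun_apply \<psi> c \<le> s + \<epsilon>" if "c \<in> Cs i" for c
      using \<psi>(2)[OF memD[OF K_mem(1) zero_le_one order_refl that]]
      by (simp add: blinfun.minus_right)
    ultimately show ?case using \<psi>(1) by blast
  qed
qed

text \<open>The Mazur-Orlicz theorem with the constant bound \<open>r\<close> on the convex set of
  differences \<open>w - c\<close>.\<close>

lemma separating_functional:
  fixes W C :: "'a::real_normed_vector set"
  assumes "convex W" "convex C" and le: "\<And>w c. w \<in> W \<Longrightarrow> c \<in> C \<Longrightarrow> r \<le> norm (w - c)"
  obtains \<phi> :: "'a \<Rightarrow>\<^sub>L real"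
  where "norm \<phi> \<le> 1" "\<And>w c. w \<in> W \<Longrightarrow> c \<in> C \<Longrightarrow> r \<le> blinfun_apply \<phi> w - blinfun_apply \<phi> c"
proof -
  let ?D = "(\<Union>w\<in>W. \<Union>c\<in>C. {w - c}) \<times> {r}"
  have "convex ?D"
    using assms(1,2) by (intro convex_Times convex_differences) auto
  moreover have "b \<le> norm x" if "(x, b) \<in> ?D" for x b
    using that le by auto
  ultimately obtain \<phi> :: "'a \<Rightarrow>\<^sub>L real" where "norm \<phi> \<le> 1"
    "\<And>x b. (x, b) \<in> ?D \<Longrightarrow> b \<le> blinfun_apply \<phi> x"
    using mazur_orlicz[of ?D] by blast
  then show thesis
    using that[of \<phi>] by (force simp flip: blinfun.diff_right)
qed

text \<open>With \<open>r = setdist W C\<close>, some \<open>\<phi>\<close> separates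
  \<open>W\<close> and \<open>C\<close> with gap \<open>r\<close>. Half of \<open>r - b\<close> is
  allowed for the change from \<open>\<phi>\<close> to \<open>\<psi>\<close> on \<open>W\<close>,
  the other half for the excess of \<open>\<psi>\<close> over \<open>s\<close> on
  \<open>Cs i\<close>, which leaves a gap of at least \<open>b\<close>.\<close>

lemma eventually_setdist_lower_bound:
  fixes W :: "'a::real_normed_vector set"
  assumes kadec: "dual_norm_weak_star_kadec TYPE('a)" and Y: "subspace Y"
    and w: "wijsman_converges Y Cs C F"
    and Cs: "eventually (\<lambda>i. closed_convex_in Y (Cs i)) F" and C: "closed_convex_in Y C" "C \<noteq> {}"
    and W: "closed_convex_in Y W" "W \<noteq> {}" "bounded W" and b: "b < setdist W C"
  shows "eventually (\<lambda>i. \<forall>w\<in>W. \<forall>c\<in>Cs i. b \<le> norm (w - c)) F"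
proof (cases "0 < setdist W C")
  case False
  with b have "b < 0" by simp
  then have "b \<le> norm x" for x :: 'a
    using norm_ge_zero[of x] by linarith
  then show ?thesis by simp
next
  case True
  define r where "r = setdist W C"
  have r: "0 < r" "b < r" using True b by (auto simp: r_def)
  have "r \<le> norm (w - c)" if "w \<in> W" "c \<in> C" for w c
    using setdist_le_dist[OF that] by (simp add: r_def dist_norm)
  moreover have "convex W" "convex C"
    using W C by (auto simp: closed_convex_in_def)
  ultimately obtain \<phi> :: "'a \<Rightarrow>\<^sub>L real" where \<phi>: "norm \<phi> \<le> 1"
    and sep: "\<And>w c. w \<in> W \<Longrightarrow> c \<in> C \<Longrightarrow> r \<le> blinfun_apply \<phi> w - blinfun_apply \<phi> c"
    using separating_functional[of W C r] by blast
  define s where "s = Sup (blinfun_apply \<phi> ` C)"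
  obtain w\<^sub>0 where w0: "w\<^sub>0 \<in> W" using W by blast
  have "bdd_above (blinfun_apply \<phi> ` C)"
    using sep[OF w0] by (intro bdd_aboveI2[where M = "blinfun_apply \<phi> w\<^sub>0 - r"]) (simp add: algebra_simps)
  then have s: "blinfun_apply \<phi> c \<le> s" if "c \<in> C" for c
    unfolding s_def using that by (intro cSUP_upper)
  have s_le: "s \<le> blinfun_apply \<phi> x - r" if "x \<in> W" for x
    unfolding s_def using sep[OF that] C(2) by (intro cSUP_least) (auto simp: algebra_simps)
  \<comment> \<open>Normalised differences \<open>w - c\<close> of nearly minimal length show that
    \<open>\<phi>\<close> has norm at least 1 on \<open>Y\<close>.\<close>
  have norming: "\<exists>y\<in>Y. norm y \<le> 1 \<and> \<eta> < blinfun_apply \<phi> y" if \<eta>: "\<eta> < 1" for \<eta>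
  proof (cases "\<eta> < 0")
    case True
    then show ?thesis using subspace_0[OF Y] by (intro bexI[of _ 0]) auto
  next
    case False
    \<comment> \<open>Otherwise all distances between \<open>W\<close> and \<open>C\<close> would be
      at least \<open>r / \<eta> > r\<close>, or \<open>r \<le> 0\<close> if
      \<open>\<eta> = 0\<close>.\<close>
    have "\<exists>w\<in>W. \<exists>c\<in>C. \<eta> * norm (w - c) < r"
    proof (rule ccontr)
      assume "\<not> ?thesis"
      then have *: "r \<le> \<eta> * norm (w - c)" if "w \<in> W" "c \<in> C" for w c
        using that by (auto simp: not_less)
      show False
      proof (cases "\<eta> = 0")
        case True
        with * w0 C(2) r show False by auto
      next
        case False
        with \<open>\<not> \<eta> < 0\<close> have "0 < \<eta>" by simp
        have "r / \<eta> \<le> setdist W C"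
          using W C * \<open>0 < \<eta>\<close> by (intro le_setdistI) (auto simp: dist_norm field_simps)
        then have "r \<le> \<eta> * r" using \<open>0 < \<eta>\<close> by (simp add: r_def field_simps)
        with \<eta> r show False by simp
      qed
    qed
    then obtain w c where wc: "w \<in> W" "c \<in> C" "\<eta> * norm (w - c) < r" by blast
    have rn: "r \<le> blinfun_apply \<phi> (w - c)"
      using sep[OF wc(1,2)] by (simp add: blinfun.diff_right)
    then have pos: "0 < norm (w - c)"
      using r by auto
    show ?thesis
    proof (intro bexI conjI)
      show "(w - c) /\<^sub>R norm (w - c) \<in> Y"
        using Y W C wc by (intro subspace_scale subspace_diff) (auto simp: closed_convex_in_def)
      show "\<eta> < blinfun_apply \<phi> ((w - c) /\<^sub>R norm (w - c))"
        using order.strict_trans2[OF wc(3) rn] pos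
        unfolding blinfun.scaleR_right by (simp add: field_simps)
      show "norm ((w - c) /\<^sub>R norm (w - c)) \<le> 1" using pos by simp
    qed
  qed
  obtain R where R: "0 < R" "\<And>x. x \<in> W \<Longrightarrow> norm x \<le> R"
    using W(3) by (auto simp: bounded_pos)
  \<comment> \<open>The tolerance \<open>(r - b) / (2 * R)\<close> per unit of norm becomes
    \<open>(r - b) / 2\<close> on \<open>W\<close>.\<close>
  obtain E \<epsilon> where E: "finite E" "E \<subseteq> Y" "0 < \<epsilon>"
    and close: "\<And>\<psi> y. norm \<psi> \<le> 1 \<Longrightarrow>
      (\<And>x. x \<in> E \<Longrightarrow> \<bar>blinfun_apply \<psi> x - blinfun_apply \<phi> x\<bar> \<le> \<epsilon>) \<Longrightarrow> y \<in> Y \<Longrightarrow>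
      \<bar>blinfun_apply \<psi> y - blinfun_apply \<phi> y\<bar> \<le> (r - b) / (2 * R) * norm y"
    by (rule kadec_neighbourhood[OF kadec norming, of "(r - b) / (2 * R)"]) (use r R in auto)
  define \<epsilon>' where "\<epsilon>' = min \<epsilon> ((r - b) / 2)"
  have "eventually (\<lambda>i. \<exists>\<psi> :: 'a \<Rightarrow>\<^sub>L real. norm \<psi> \<le> 1 \<and>
    (\<forall>x\<in>E. \<bar>blinfun_apply \<psi> x - blinfun_apply \<phi> x\<bar> \<le> \<epsilon>') \<and>
    (\<forall>c\<in>Cs i. blinfun_apply \<psi> c \<le> s + \<epsilon>')) F"
  proof (rule eventually_approximate_functional[OF w Y _ \<phi> s C(2) E(1,2)])
    show "eventually (\<lambda>i. convex (Cs i)) F"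
      using Cs by eventually_elim (simp add: closed_convex_in_def)
    show "0 < \<epsilon>'" using E r by (simp add: \<epsilon>'_def)
  qed
  then show ?thesis
  proof eventually_elim
    case (elim i)
    then obtain \<psi> :: "'a \<Rightarrow>\<^sub>L real" where \<psi>: "norm \<psi> \<le> 1"
      "\<forall>x\<in>E. \<bar>blinfun_apply \<psi> x - blinfun_apply \<phi> x\<bar> \<le> \<epsilon>'"
      "\<forall>c\<in>Cs i. blinfun_apply \<psi> c \<le> s + \<epsilon>'" by blast
    show ?case
    proof (intro ballI)
      fix x c assume x: "x \<in> W" and c: "c \<in> Cs i"
      have "\<bar>blinfun_apply \<psi> x - blinfun_apply \<phi> x\<bar> \<le> (r - b) / (2 * R) * norm x"
        using \<psi> x W(1) by (intro close) (auto simp: \<epsilon>'_def closed_convex_in_def)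
      also have "\<dots> \<le> (r - b) / (2 * R) * R"
        using r R x by (intro mult_left_mono) auto
      also have "\<dots> = (r - b) / 2" using R by simp
      finally have "blinfun_apply \<phi> x - (r - b) / 2 \<le> blinfun_apply \<psi> x" by linarith
      moreover have "blinfun_apply \<psi> c \<le> s + (r - b) / 2"
        using \<psi>(3) c by (force simp: \<epsilon>'_def)
      moreover have "blinfun_apply \<psi> x - blinfun_apply \<psi> c \<le> norm (x - c)"
        using abs_blinfun_le[OF \<psi>(1), of "x - c"] by (simp add: blinfun.diff_right)
      ultimately show "b \<le> norm (x - c)"
        using s_le[OF x] by (simp add: field_simps)
    qed
  qed
qed

text \<open>The upper estimate comes from a single point of \<open>W\<close> that is close enough to
  \<open>C\<close>. The lower one is \<open>eventually_setdist_lower_bound\<close> for nonempty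
  sets; empty \<open>W\<close> or \<open>C\<close> is treated separately.\<close>

lemma wijsman_converges_imp_slice:
  fixes Y :: "'a::real_normed_vector set"
  assumes kadec: "dual_norm_weak_star_kadec TYPE('a)" and Y: "subspace Y"
    and w: "wijsman_converges Y Cs C F"
    and Cs: "eventually (\<lambda>i. closed_convex_in Y (Cs i)) F" and C: "closed_convex_in Y C"
  shows "slice_converges Y Cs C F"
  unfolding slice_converges_def
proof (intro allI impI order_tendstoI)
  fix W a assume "closed_convex_in Y W \<and> bounded W"
  then have W: "closed_convex_in Y W" "bounded W" by auto
  then have WY: "W \<subseteq> Y" by (simp add: closed_convex_in_def)
  {
    assume "ext_setdist W C < a"
    then obtain x where x: "x \<in> W" "ext_infdist x C < a"
      by (auto simp: ext_setdist_less_iff ext_infdist_less_iff)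
    have "((\<lambda>i. ext_infdist x (Cs i)) \<longlongrightarrow> ext_infdist x C) F"
      using w x WY by (auto simp: wijsman_converges_def)
    then have "eventually (\<lambda>i. ext_infdist x (Cs i) < a) F"
      using x(2) by (rule order_tendstoD(2))
    then show "eventually (\<lambda>i. ext_setdist W (Cs i) < a) F"
      by eventually_elim (use x(1) in \<open>auto simp: ext_setdist_less_iff ext_infdist_less_iff\<close>)
  next
    assume "a < ext_setdist W C"
    \<comment> \<open>A real \<open>b\<close> strictly in between turns a non-strict bound for all
      pairs into a strict one for the infimum.\<close>
    then obtain b where b: "a < ereal b" "ereal b < ext_setdist W C"
      using ereal_dense2 by blast
    have "eventually (\<lambda>i. \<forall>x\<in>W. \<forall>c\<in>Cs i. b \<le> norm (x - c)) F"
    proof (cases "W = {} \<or> C = {}")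
      case False
      then show ?thesis
        using b(2) by (intro eventually_setdist_lower_bound[OF kadec Y w Cs C _ W(1) _ W(2)])
          (auto simp: ext_setdist_eq_setdist)
    next
      case True
      show ?thesis
      proof (cases "W = {}")
        case False
        with True have "C = {}" by simp
        from False obtain x where x: "x \<in> W" by blast
        obtain R where R: "\<And>x. x \<in> W \<Longrightarrow> norm x \<le> R"
          using W(2) by (auto simp: bounded_iff)
        have "((\<lambda>i. ext_infdist x (Cs i)) \<longlongrightarrow> \<infinity>) F"
          using w x WY by (auto simp: wijsman_converges_def \<open>C = {}\<close> ext_infdist_empty)
        \<comment> \<open>Two points of \<open>W\<close> are at most \<open>2 * R\<close> apart, so
          this bound at \<open>x\<close> leaves \<open>b\<close> at every point of
          \<open>W\<close>.\<close>
        then have "eventually (\<lambda>i. ereal (b + 2 * R) < ext_infdist x (Cs i)) F"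
          by (rule order_tendstoD(1)) simp
        then show ?thesis
        proof eventually_elim
          case (elim i)
          show ?case
          proof (intro ballI)
            fix y c assume y: "y \<in> W" and c: "c \<in> Cs i"
            have "ereal (b + 2 * R) \<le> ext_infdist x (Cs i)"
              using elim by (rule less_imp_le)
            then have "b + 2 * R \<le> norm (x - c)"
              using c unfolding le_ext_infdist_iff by simp
            moreover have "norm (x - c) \<le> norm x + norm y + norm (y - c)"
              using norm_triangle_ineq[of "x - y" "y - c"] norm_triangle_ineq4[of x y] by simp
            ultimately show "b \<le> norm (y - c)" using R[OF x] R[OF y] by linarith
          qed
        qed
      qed simp
    qed
    then show "eventually (\<lambda>i. a < ext_setdist W (Cs i)) F"
    proof eventually_elim
      case (elim i)
      then have "ereal b \<le> ext_setdist W (Cs i)" by (simp add: le_ext_setdist_iff)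
      with b(1) show ?case by (rule less_le_trans)
    qed
  }
qed

lemma wijsman_slice_coincide_net_if_kadec:
  fixes Y :: "'a::real_normed_vector set"
  assumes "dual_norm_weak_star_kadec TYPE('a)" "subspace Y"
  shows "wijsman_slice_coincide_net Y"
  unfolding wijsman_slice_coincide_net_def
proof (intro allI impI iffI)
  fix I :: "'a set net_index set" and le Cs C
  assume *: "directed_set I le \<and> (\<forall>i\<in>I. closed_convex_in Y (Cs i)) \<and> closed_convex_in Y C"
  then have "eventually (\<lambda>i. closed_convex_in Y (Cs i)) (tails I le)"
    by (auto simp: eventually_tails directed_set_def)
  with * assms show "slice_converges Y Cs C (tails I le)" if "wijsman_converges Y Cs C (tails I le)"
    using that by (intro wijsman_converges_imp_slice) auto
qed (rule slice_converges_imp_wijsman)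

lemma tails_nat: "tails UNIV (\<le>) = (sequentially :: nat filter)"
  by (simp add: tails_def eventually_sequentially filter_eq_iff at_top_def atLeast_def)

text \<open>A sequence is a net over \<open>nat\<close>, and
  \<open>wijsman_slice_coincide_net_any_index\<close> covers that index type.\<close>

lemma wijsman_slice_coincide_seq_if_net:
  assumes "wijsman_slice_coincide_net Y"
  shows "wijsman_slice_coincide_seq Y"
  unfolding wijsman_slice_coincide_seq_def tails_nat[symmetric]
proof (intro allI impI wijsman_slice_coincide_net_any_index[OF assms])
  show "directed_set UNIV ((\<le>) :: nat \<Rightarrow> _)"
    by (auto simp: directed_set_def reflp_on_def transp_on_def intro: max.cobounded1 max.cobounded2)
qed auto


section \<open>From slice convergence to the Kadec property\<close>

text \<open>The limit is Ascoli's formula for the distance from \<open>y\<close> to the hyperplane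
  \<open>l = 1\<close> of \<open>Y\<close>, as \<open>norming\<close> says that \<open>l\<close>
  keeps its full norm on \<open>Y\<close>. Lower bounds use \<open>norm (\<phi> i)\<close>, upper
  bounds a nearly norming vector of \<open>l\<close>.\<close>

lemma hyperplane_ext_infdist_tendsto:
  fixes l :: "'a::real_normed_vector \<Rightarrow>\<^sub>L real"
  assumes Y: "subspace Y" and y: "y \<in> Y" and l: "0 < norm l"
    and lim: "\<And>x. x \<in> Y \<Longrightarrow> ((\<lambda>i. blinfun_apply (\<phi> i) x) \<longlongrightarrow> blinfun_apply l x) F"
    and norm: "((\<lambda>i. norm (\<phi> i)) \<longlongrightarrow> norm l) F"
    and norming: "\<And>\<eta>. \<eta> < norm l \<Longrightarrow> \<exists>u\<in>Y. norm u \<le> 1 \<and> \<eta> < blinfun_apply l u"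
  shows "((\<lambda>i. ext_infdist y {x\<in>Y. blinfun_apply (\<phi> i) x = 1})
    \<longlongrightarrow> ereal (\<bar>1 - blinfun_apply l y\<bar> / norm l)) F"
proof (rule order_tendstoI)
  fix a assume "a < ereal (\<bar>1 - blinfun_apply l y\<bar> / norm l)"
  then obtain b where b: "a < ereal b" "ereal b < ereal (\<bar>1 - blinfun_apply l y\<bar> / norm l)"
    using ereal_dense2 by blast
  \<comment> \<open>The inequality \<open>b < \<bar>1 - l y\<bar> / norm l\<close> is multiplied
    out, so that it passes to \<open>\<phi> i\<close> without quotients.\<close>
  have "((\<lambda>i. \<bar>1 - blinfun_apply (\<phi> i) y\<bar> - b * norm (\<phi> i))
      \<longlongrightarrow> \<bar>1 - blinfun_apply l y\<bar> - b * norm l) F"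
    by (intro tendsto_intros lim y norm)
  moreover have "0 < \<bar>1 - blinfun_apply l y\<bar> - b * norm l"
    using b(2) l by (simp add: field_simps)
  ultimately have "eventually (\<lambda>i. 0 < \<bar>1 - blinfun_apply (\<phi> i) y\<bar> - b * norm (\<phi> i)) F"
    by (rule order_tendstoD(1))
  then show "eventually (\<lambda>i. a < ext_infdist y {x\<in>Y. blinfun_apply (\<phi> i) x = 1}) F"
  proof eventually_elim
    case (elim i)
    have "b \<le> norm (y - x)" if "blinfun_apply (\<phi> i) x = 1" for x
    proof -
      have "\<bar>1 - blinfun_apply (\<phi> i) y\<bar> \<le> norm (\<phi> i) * norm (y - x)"
        using abs_blinfun_le[OF order_refl, of "\<phi> i" "y - x"] that
        by (simp add: blinfun.diff_right abs_minus_commute)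
      with elim have "norm (\<phi> i) * b < norm (\<phi> i) * norm (y - x)"
        by (simp add: mult.commute)
      then show ?thesis by (simp add: mult_less_cancel_left)
    qed
    then have "ereal b \<le> ext_infdist y {x\<in>Y. blinfun_apply (\<phi> i) x = 1}"
      by (simp add: le_ext_infdist_iff)
    with b(1) show ?case by (rule less_le_trans)
  qed
next
  fix a assume "ereal (\<bar>1 - blinfun_apply l y\<bar> / norm l) < a"
  then obtain b where b: "ereal (\<bar>1 - blinfun_apply l y\<bar> / norm l) < ereal b" "ereal b < a"
    using ereal_dense2 by blast
  then have "\<bar>1 - blinfun_apply l y\<bar> / norm l < b" by simp
  then have b0: "0 < b" by (rule le_less_trans[rotated]) simp
  with b(1) l have "\<bar>1 - blinfun_apply l y\<bar> / b < norm l"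
    by (simp add: field_simps)
  \<comment> \<open>From \<open>y\<close>, a multiple of \<open>u\<close> with coefficient less than
    \<open>b\<close> in absolute value reaches the hyperplane \<open>l = 1\<close>; the same will
    hold for \<open>\<phi> i\<close>.\<close>
  then obtain u where u: "u \<in> Y" "norm u \<le> 1" "\<bar>1 - blinfun_apply l y\<bar> / b < blinfun_apply l u"
    using norming by blast
  moreover have "0 \<le> \<bar>1 - blinfun_apply l y\<bar> / b" using b0 by simp
  ultimately have lu: "0 < blinfun_apply l u" by linarith
  have "((\<lambda>i. b * blinfun_apply (\<phi> i) u - \<bar>1 - blinfun_apply (\<phi> i) y\<bar>)
      \<longlongrightarrow> b * blinfun_apply l u - \<bar>1 - blinfun_apply l y\<bar>) F"
    by (intro tendsto_intros lim y u)
  moreover have "0 < b * blinfun_apply l u - \<bar>1 - blinfun_apply l y\<bar>"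
    using u(3) b0 by (simp add: field_simps)
  ultimately have "eventually (\<lambda>i. 0 < b * blinfun_apply (\<phi> i) u - \<bar>1 - blinfun_apply (\<phi> i) y\<bar>) F"
    by (rule order_tendstoD(1))
  moreover have "eventually (\<lambda>i. 0 < blinfun_apply (\<phi> i) u) F"
    using lim[OF u(1)] lu by (rule order_tendstoD(1))
  ultimately show "eventually (\<lambda>i. ext_infdist y {x\<in>Y. blinfun_apply (\<phi> i) x = 1} < a) F"
  proof eventually_elim
    case (elim i)
    define t where "t = (1 - blinfun_apply (\<phi> i) y) / blinfun_apply (\<phi> i) u"
    have "y + t *\<^sub>R u \<in> Y"
      using Y y u by (intro subspace_add subspace_scale)
    moreover have "blinfun_apply (\<phi> i) (y + t *\<^sub>R u) = 1"
      using elim by (simp add: t_def blinfun.add_right blinfun.scaleR_right)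
    moreover have "norm (y - (y + t *\<^sub>R u)) < b"
    proof -
      have "norm (y - (y + t *\<^sub>R u)) = \<bar>t\<bar> * norm u" by simp
      also have "\<dots> \<le> \<bar>t\<bar>" using u(2) mult_left_mono[of "norm u" 1 "\<bar>t\<bar>"] by simp
      also have "\<dots> < b" using elim by (simp add: t_def field_simps)
      finally show ?thesis .
    qed
    ultimately have "ext_infdist y {x\<in>Y. blinfun_apply (\<phi> i) x = 1} < ereal b"
      unfolding ext_infdist_less_iff by (intro bexI[of _ "y + t *\<^sub>R u"]) auto
    then show ?case using b(2) by (rule less_trans)
  qed
qed

section \<open>Closed spans of countable sets\<close>

lemma subspace_closure:
  fixes S :: "'a::real_normed_vector set"
  assumes S: "subspace S"
  shows "subspace (closure S)"
proof (rule subspaceI)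
  show "0 \<in> closure S"
    using subspace_0[OF S] closure_subset by blast
next
  fix x y assume "x \<in> closure S" "y \<in> closure S"
  then have "(x, y) \<in> closure (S \<times> S)"
    by (simp add: closure_Times)
  moreover have "(\<lambda>p. fst p + snd p) ` closure (S \<times> S) \<subseteq> closure S"
    by (rule image_closure_subset)
      (use S closure_subset in \<open>auto intro!: continuous_intros subsetD[OF closure_subset] subspace_add\<close>)
  ultimately show "x + y \<in> closure S" by force
next
  fix c x assume "x \<in> closure S"
  moreover have "(\<lambda>x. c *\<^sub>R x) ` closure S \<subseteq> closure S"
    by (rule image_closure_subset)
      (use S in \<open>auto intro!: continuous_intros subsetD[OF closure_subset] subspace_scale\<close>)
  ultimately show "c *\<^sub>R x \<in> closure S" by blast
qed

text \<open>The finite rational combinations of \<open>A\<close>, encoded by lists of pairs, form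
  the countable dense set \<open>Q\<close>.\<close>

lemma separable_closure_span:
  fixes A :: "'a::real_normed_vector set"
  assumes A: "countable A"
  shows "separable_space (top_of_set (closure (span A)))"
proof -
  define c where "c = (\<lambda>xs. \<Sum>(q, a)\<leftarrow>xs. real_of_rat q *\<^sub>R (a :: 'a))"
  define Q where "Q = c ` lists (UNIV \<times> A)"
  have "countable Q"
    unfolding Q_def using A by (intro countable_image countable_lists countable_SIGMA) auto
  have "c xs \<in> span A" if "xs \<in> lists (UNIV \<times> A)" for xs
    using that by (induction xs) (auto simp: c_def intro: span_zero span_add span_scale span_base)
  then have QA: "Q \<subseteq> span A" by (auto simp: Q_def)
  have step: "q *\<^sub>R a + y \<in> Q" if q: "q \<in> \<rat>" and a: "a \<in> A" and y: "y \<in> Q" for q a y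
  proof -
    obtain r where r: "q = real_of_rat r" using q by (auto simp: Rats_def)
    obtain xs where xs: "xs \<in> lists (UNIV \<times> A)" "y = c xs" using y by (auto simp: Q_def)
    have "q *\<^sub>R a + y = c ((r, a) # xs)" by (simp add: c_def r xs(2))
    with xs(1) a show ?thesis unfolding Q_def by (intro image_eqI[of _ _ "(r, a) # xs"]) auto
  qed
  have "span A \<subseteq> closure Q"
  proof
    fix x assume "x \<in> span A"
    then show "x \<in> closure Q"
    proof (induction rule: span_induct_alt)
      case base
      have "c [] \<in> Q" unfolding Q_def by (intro imageI) auto
      then show ?case using closure_subset by (auto simp: c_def)
    next
      case (step t a y)
      \<comment> \<open>Continuity of \<open>?f\<close> extends closedness under rational multiples
        of \<open>a\<close> to real ones, and from \<open>Q\<close> to its closure.\<close>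
      let ?f = "\<lambda>(q, z). q *\<^sub>R a + z"
      have "?f ` closure (\<rat> \<times> Q) \<subseteq> closure Q"
      proof (rule image_closure_subset)
        show "continuous_on (closure (\<rat> \<times> Q)) ?f"
          unfolding case_prod_beta by (intro continuous_intros)
        show "?f ` (\<rat> \<times> Q) \<subseteq> closure Q"
          using \<open>\<And>q a y. q \<in> \<rat> \<Longrightarrow> a \<in> A \<Longrightarrow> y \<in> Q \<Longrightarrow> q *\<^sub>R a + y \<in> Q\<close> step closure_subset by fast
      qed simp
      moreover have "(t, y) \<in> closure (\<rat> \<times> Q)"
        using step by (simp add: closure_Times Rats_closure_real)
      ultimately show ?case by force
    qed
  qed
  then have "closure (span A) \<subseteq> closure Q"
    by (simp add: closure_minimal)
  then have "top_of_set (closure (span A)) closure_of Q = closure (span A)"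
    using QA closure_subset[of "span A"] by (auto simp: closure_of_subtopology Int_absorb1 Int_absorb2)
  moreover have "Q \<subseteq> closure (span A)"
    using QA closure_subset by blast
  ultimately show ?thesis
    unfolding separable_space_def using \<open>countable Q\<close> by auto
qed

text \<open>Linearity carries the convergence from \<open>A\<close> to its span; the uniform norm
  bound carries it to the closure.\<close>

lemma tendsto_closure_span:
  fixes \<phi> :: "'i \<Rightarrow> 'a::real_normed_vector \<Rightarrow>\<^sub>L real"
  assumes lim: "\<And>x. x \<in> A \<Longrightarrow> ((\<lambda>i. blinfun_apply (\<phi> i) x) \<longlongrightarrow> blinfun_apply l x) F"
    and bound: "eventually (\<lambda>i. norm (\<phi> i) \<le> B) F" and x: "x \<in> closure (span A)"
  shows "((\<lambda>i. blinfun_apply (\<phi> i) x) \<longlongrightarrow> blinfun_apply l x) F"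
proof (rule tendstoI)
  fix e :: real assume e: "0 < e"
  have span: "((\<lambda>i. blinfun_apply (\<phi> i) z) \<longlongrightarrow> blinfun_apply l z) F" if "z \<in> span A" for z
    using that
  proof (induction rule: span_induct_alt)
    case (step c a z)
    then show ?case
      unfolding blinfun.add_right blinfun.scaleR_right real_scaleR_def
      by (intro tendsto_add tendsto_mult_left) (auto intro: lim)
  qed simp
  define M where "M = \<bar>B\<bar> + norm l + 1"
  have M: "0 < M" by (simp add: M_def add_nonneg_pos)
  obtain z where z: "z \<in> span A" "norm (x - z) < e / (2 * M)"
    using x e M closure_approachable[of x "span A"]
    by (metis dist_commute dist_norm divide_pos_pos mult_pos_pos zero_less_numeral)
  have "eventually (\<lambda>i. dist (blinfun_apply (\<phi> i) z) (blinfun_apply l z) < e / 2) F"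
    by (rule tendstoD[OF span[OF z(1)]]) (use e in simp)
  with bound show "eventually (\<lambda>i. dist (blinfun_apply (\<phi> i) x) (blinfun_apply l x) < e) F"
  proof eventually_elim
    case (elim i)
    have "norm (\<phi> i - l) \<le> M"
      using norm_triangle_ineq4[of "\<phi> i" l] elim(1) by (simp add: M_def)
    then have "\<bar>blinfun_apply (\<phi> i - l) (x - z)\<bar> \<le> M * norm (x - z)"
      by (rule abs_blinfun_le)
    also have "\<dots> \<le> e / 2" using z(2) M by (simp add: field_simps)
    finally show ?case
      using elim(2) unfolding dist_real_def blinfun.diff_left blinfun.diff_right by linarith
  qed
qed

text \<open>The symmetry of the unit ball allows the absolute value in the operator norm to be
  dropped.\<close>

lemma norm_blinfun_less_obtain:
  fixes \<psi> :: "'a::real_normed_vector \<Rightarrow>\<^sub>L real"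
  assumes "c < norm \<psi>"
  obtains x where "norm x \<le> 1" "c < blinfun_apply \<psi> x"
proof -
  have "\<exists>x. norm x \<le> 1 \<and> c < blinfun_apply \<psi> x"
  proof (rule ccontr)
    assume none: "\<not> ?thesis"
    have c: "0 \<le> c" using none[unfolded not_ex, rule_format, of 0] by simp
    have le: "blinfun_apply \<psi> x \<le> c * norm x" for x
    proof (cases "x = 0")
      case False
      then have "norm (x /\<^sub>R norm x) \<le> 1" by simp
      with none have "blinfun_apply \<psi> (x /\<^sub>R norm x) \<le> c" by (meson not_less)
      with False show ?thesis
        unfolding blinfun.scaleR_right by (simp add: field_simps)
    qed simp
    have "norm \<psi> \<le> c"
    proof (rule norm_blinfun_bound[OF c])
      show "norm (blinfun_apply \<psi> x) \<le> c * norm x" for x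
        using le[of x] le[of "- x"] by (simp add: blinfun.minus_right abs_le_iff)
    qed
    with assms show False by simp
  qed
  with that show thesis by blast
qed

text \<open>A net violating the property is frequently at distance at least \<open>e\<close> from
  \<open>l\<close>, yet eventually in every basic weak* neighbourhood of \<open>l\<close> with norms
  close to \<open>norm l\<close>. The gap \<open>e\<close> is the same for all \<open>E\<close> and
  \<open>\<epsilon>\<close>.\<close>

lemma not_kadec_obtain:
  assumes "\<not> dual_norm_weak_star_kadec TYPE('a::real_normed_vector)"
  obtains l :: "'a::real_normed_vector \<Rightarrow>\<^sub>L real" and e where "0 < norm l" "0 < e"
    "\<And>E \<epsilon>. finite E \<Longrightarrow> 0 < \<epsilon> \<Longrightarrow> \<exists>\<psi> :: 'a::real_normed_vector \<Rightarrow>\<^sub>L real.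
      (\<forall>x\<in>E. \<bar>blinfun_apply \<psi> x - blinfun_apply l x\<bar> < \<epsilon>) \<and> \<bar>norm \<psi> - norm l\<bar> < \<epsilon> \<and> e \<le> norm (\<psi> - l)"
proof -
  obtain I :: "('a \<Rightarrow>\<^sub>L real) net_index set" and le f and l :: "'a \<Rightarrow>\<^sub>L real"
    where lim: "limitin weak_star_topology f l (tails I le)"
      and norm: "((\<lambda>i. norm (f i)) \<longlongrightarrow> norm l) (tails I le)"
      and not: "\<not> ((\<lambda>i. norm (f i - l)) \<longlongrightarrow> 0) (tails I le)"
    using assms unfolding dual_norm_weak_star_kadec_def by blast
  obtain e where e: "0 < e" "\<not> eventually (\<lambda>i. norm (f i - l) < e) (tails I le)"
    using not by (auto simp: tendsto_iff)
  \<comment> \<open>At \<open>l = 0\<close> convergence of the norms is already norm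
    convergence.\<close>
  have "l \<noteq> 0" using norm not by auto
  moreover have "\<exists>\<psi> :: 'a \<Rightarrow>\<^sub>L real. (\<forall>x\<in>E. \<bar>blinfun_apply \<psi> x - blinfun_apply l x\<bar> < \<epsilon>) \<and>
      \<bar>norm \<psi> - norm l\<bar> < \<epsilon> \<and> e \<le> norm (\<psi> - l)" if "finite E" "0 < \<epsilon>" for E \<epsilon>
  proof (rule ccontr)
    assume none: "\<not> ?thesis"
    have "eventually (\<lambda>i. \<bar>norm (f i) - norm l\<bar> < \<epsilon>) (tails I le)"
      using tendstoD[OF norm that(2)] by (simp add: dist_real_def)
    moreover have "eventually (\<lambda>i. \<bar>blinfun_apply (f i) x - blinfun_apply l x\<bar> < \<epsilon>) (tails I le)" for x
    proof -
      have "((\<lambda>i. blinfun_apply (f i) x) \<longlongrightarrow> blinfun_apply l x) (tails I le)"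
        using lim unfolding limitin_weak_star_iff by blast
      from tendstoD[OF this that(2)] show ?thesis by (simp add: dist_real_def)
    qed
    then have "eventually (\<lambda>i. \<forall>x\<in>E. \<bar>blinfun_apply (f i) x - blinfun_apply l x\<bar> < \<epsilon>) (tails I le)"
      using that(1) by (simp add: eventually_ball_finite)
    ultimately have "eventually (\<lambda>i. norm (f i - l) < e) (tails I le)"
      by eventually_elim (use none in \<open>auto simp: not_le\<close>)
    with e(2) show False by simp
  qed
  ultimately show thesis using that e(1) by auto
qed

text \<open>Finite sets \<open>S n\<close> grow by a nearly norming vector \<open>u n\<close> of
  \<open>l\<close> and by a vector \<open>p (\<phi> n)\<close> on which \<open>\<phi> n\<close> and
  \<open>l\<close> differ by more than \<open>e / 2\<close>. On the closed span of their union,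
  \<open>l\<close> keeps its norm and the gap stays visible.\<close>

lemma not_kadec_separable_subspace:
  assumes "\<not> dual_norm_weak_star_kadec TYPE('a::real_normed_vector)"
  obtains Y :: "'a::real_normed_vector set" and l :: "'a::real_normed_vector \<Rightarrow>\<^sub>L real" and \<phi> :: "nat \<Rightarrow> 'a::real_normed_vector \<Rightarrow>\<^sub>L real" and y \<delta>
  where "subspace Y" "closed Y" "separable_space (top_of_set Y)" "0 < norm l"
    "\<And>x. x \<in> Y \<Longrightarrow> (\<lambda>n. blinfun_apply (\<phi> n) x) \<longlonglongrightarrow> blinfun_apply l x"
    "(\<lambda>n. norm (\<phi> n)) \<longlonglongrightarrow> norm l"
    "\<And>\<eta>. \<eta> < norm l \<Longrightarrow> \<exists>u\<in>Y. norm u \<le> 1 \<and> \<eta> < blinfun_apply l u"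
    "0 < \<delta>" "\<And>n. y n \<in> Y" "\<And>n. norm (y n) \<le> 1"
    "\<And>n. \<delta> < blinfun_apply (\<phi> n) (y n) - blinfun_apply l (y n)"
proof -
  obtain l :: "'a \<Rightarrow>\<^sub>L real" and e where l: "0 < norm l" and e: "0 < e"
    and ex: "\<And>E \<epsilon>. finite E \<Longrightarrow> 0 < \<epsilon> \<Longrightarrow> \<exists>\<psi> :: 'a \<Rightarrow>\<^sub>L real.
      (\<forall>x\<in>E. \<bar>blinfun_apply \<psi> x - blinfun_apply l x\<bar> < \<epsilon>) \<and> \<bar>norm \<psi> - norm l\<bar> < \<epsilon> \<and> e \<le> norm (\<psi> - l)"
    using not_kadec_obtain[OF assms] by blast
  obtain \<Psi> where \<Psi>: "\<And>E \<epsilon>. finite E \<Longrightarrow> 0 < \<epsilon> \<Longrightarrow>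
      (\<forall>x\<in>E. \<bar>blinfun_apply (\<Psi> E \<epsilon>) x - blinfun_apply l x\<bar> < \<epsilon>) \<and> \<bar>norm (\<Psi> E \<epsilon>) - norm l\<bar> < \<epsilon> \<and>
      e \<le> norm (\<Psi> E \<epsilon> - l)"
    using ex by metis
  have "\<exists>x. norm x \<le> 1 \<and> e / 2 < blinfun_apply (\<psi> - l) x" if "e \<le> norm (\<psi> - l)" for \<psi>
    using norm_blinfun_less_obtain[of "e / 2" "\<psi> - l"] that e by force
  then obtain p where p: "\<And>\<psi>. e \<le> norm (\<psi> - l) \<Longrightarrow> norm (p \<psi>) \<le> 1 \<and> e / 2 < blinfun_apply (\<psi> - l) (p \<psi>)"
    by metis
  have "\<exists>u. norm u \<le> 1 \<and> norm l - inverse (real (Suc n)) < blinfun_apply l u" for n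
    using norm_blinfun_less_obtain[of "norm l - inverse (real (Suc n))" l] by force
  then obtain u where u: "\<And>n. norm (u n) \<le> 1 \<and> norm l - inverse (real (Suc n)) < blinfun_apply l (u n)"
    by metis
  \<comment> \<open>\<open>\<phi> n\<close> has to be close to \<open>l\<close> only on
    \<open>S n\<close>; its own witness \<open>p (\<phi> n)\<close> enters afterwards, so that only
    later functionals are tested there.\<close>
  define S where "S = rec_nat {} (\<lambda>n T. T \<union> {u n, p (\<Psi> T (inverse (real (Suc n))))})"
  define \<phi> where "\<phi> n = \<Psi> (S n) (inverse (real (Suc n)))" for n
  have S_Suc: "S (Suc n) = S n \<union> {u n, p (\<phi> n)}" for n
    by (simp add: S_def \<phi>_def)
  have fin: "finite (S n)" for n
  proof (induction n)
    case 0 show ?case by (simp add: S_def)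
  qed (simp add: S_Suc)
  have mono: "S m \<subseteq> S n" if "m \<le> n" for m n
    using that by (rule lift_Suc_mono_le[of S, rotated]) (auto simp: S_Suc)
  have \<phi>: "\<And>x. x \<in> S n \<Longrightarrow> \<bar>blinfun_apply (\<phi> n) x - blinfun_apply l x\<bar> < inverse (real (Suc n))"
    "\<bar>norm (\<phi> n) - norm l\<bar> < inverse (real (Suc n))" "e \<le> norm (\<phi> n - l)" for n
    using \<Psi>[OF fin[of n], of "inverse (real (Suc n))"] by (auto simp: \<phi>_def)
  define A where "A = (\<Union>n. S n)"
  define Y where "Y = closure (span A)"
  have AY: "A \<subseteq> Y"
    unfolding Y_def using span_superset closure_subset by blast
  have up: "u n \<in> Y" "p (\<phi> n) \<in> Y" for n
    using AY S_Suc[of n] by (auto simp: A_def)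
  have norm: "(\<lambda>n. norm (\<phi> n)) \<longlonglongrightarrow> norm l"
  proof (rule LIM_zero_cancel, rule Lim_null_comparison[OF _ LIMSEQ_inverse_real_of_nat])
    show "eventually (\<lambda>n. norm (norm (\<phi> n) - norm l) \<le> inverse (real (Suc n))) sequentially"
      using \<phi>(2) by (intro always_eventually allI) (simp add: less_imp_le del: of_nat_Suc)
  qed
  have bound: "eventually (\<lambda>n. norm (\<phi> n) \<le> norm l + 1) sequentially"
    using order_tendstoD(2)[OF norm, of "norm l + 1"] by (auto elim: eventually_mono)
  have lim_A: "(\<lambda>n. blinfun_apply (\<phi> n) x) \<longlonglongrightarrow> blinfun_apply l x" if x: "x \<in> A" for x
  proof (rule LIM_zero_cancel, rule Lim_null_comparison[OF _ LIMSEQ_inverse_real_of_nat])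
    obtain m where "x \<in> S m" using x by (auto simp: A_def)
    then have "x \<in> S n" if "m \<le> n" for n using mono[OF that] by blast
    then show "eventually (\<lambda>n. norm (blinfun_apply (\<phi> n) x - blinfun_apply l x) \<le> inverse (real (Suc n))) sequentially"
      using \<phi>(1) unfolding eventually_sequentially by (metis less_imp_le real_norm_def)
  qed
  show thesis
  proof (rule that[of Y l \<phi> "e / 2" "\<lambda>n. p (\<phi> n)"])
    show "subspace Y" by (simp add: Y_def subspace_closure)
    show "closed Y" by (simp add: Y_def)
    show "separable_space (top_of_set Y)"
      unfolding Y_def using fin by (intro separable_closure_span) (auto simp: A_def countable_finite)
    show "(\<lambda>n. blinfun_apply (\<phi> n) x) \<longlonglongrightarrow> blinfun_apply l x" if "x \<in> Y" for x
      using lim_A bound that unfolding Y_def by (rule tendsto_closure_span)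
    show "\<exists>u\<in>Y. norm u \<le> 1 \<and> \<eta> < blinfun_apply l u" if \<eta>: "\<eta> < norm l" for \<eta>
    proof -
      obtain n where "inverse (real (Suc n)) < norm l - \<eta>"
        using reals_Archimedean[of "norm l - \<eta>"] \<eta> by (auto simp del: of_nat_Suc)
      with u[of n] up(1)[of n] show ?thesis by (intro bexI[of _ "u n"]) auto
    qed
    show "e / 2 < blinfun_apply (\<phi> n) (p (\<phi> n)) - blinfun_apply l (p (\<phi> n))" for n
      using p[OF \<phi>(3)] by (simp add: blinfun.diff_left)
  qed (use l e norm up p \<phi>(3) in auto)
qed

lemma kadec_if_wijsman_slice_coincide_seq:
  assumes coincide: "\<And>Y :: 'a::real_normed_vector set. subspace Y \<Longrightarrow> closed Y \<Longrightarrow>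
    separable_space (top_of_set Y) \<Longrightarrow> wijsman_slice_coincide_seq Y"
  shows "dual_norm_weak_star_kadec TYPE('a)"
proof (rule ccontr)
  assume "\<not> ?thesis"
  then show False
  proof (rule not_kadec_separable_subspace)
    fix Y :: "'a set" and l :: "'a \<Rightarrow>\<^sub>L real" and \<phi> :: "nat \<Rightarrow> 'a \<Rightarrow>\<^sub>L real" and y \<delta>
    assume Y: "subspace Y" "closed Y" "separable_space (top_of_set Y)" and l: "0 < norm l"
      and lim: "\<And>x. x \<in> Y \<Longrightarrow> (\<lambda>n. blinfun_apply (\<phi> n) x) \<longlonglongrightarrow> blinfun_apply l x"
      and norm: "(\<lambda>n. norm (\<phi> n)) \<longlonglongrightarrow> norm l"
      and norming: "\<And>\<eta>. \<eta> < norm l \<Longrightarrow> \<exists>u\<in>Y. norm u \<le> 1 \<and> \<eta> < blinfun_apply l u"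
      and \<delta>: "0 < \<delta>" and y: "\<And>n. y n \<in> Y" "\<And>n. norm (y n) \<le> 1"
        "\<And>n. \<delta> < blinfun_apply (\<phi> n) (y n) - blinfun_apply l (y n)"
    define C where "C \<psi> = {x\<in>Y. blinfun_apply \<psi> x = 1}" for \<psi> :: "'a \<Rightarrow>\<^sub>L real"
    have level: "closed_convex_in Y {x\<in>Y. blinfun_apply \<psi> x = c}" for \<psi> :: "'a \<Rightarrow>\<^sub>L real" and c
    proof -
      have "closed {x. blinfun_apply \<psi> x = c}"
        by (intro closed_Collect_eq continuous_intros)
      moreover have "convex {x\<in>Y. blinfun_apply \<psi> x = c}"
        unfolding convex_def
        by (auto simp: blinfun.add_right blinfun.scaleR_right Y(1) subspace_add subspace_scale
            simp flip: distrib_right)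
      moreover have "{x\<in>Y. blinfun_apply \<psi> x = c} = Y \<inter> {x. blinfun_apply \<psi> x = c}" by auto
      ultimately show ?thesis using Y(2) by (auto simp: closed_convex_in_def)
    qed
    \<comment> \<open>The formula for the limit hyperplane itself is the case of a constant
      sequence.\<close>
    have "ext_infdist x (C l) = ereal (\<bar>1 - blinfun_apply l x\<bar> / norm l)" if "x \<in> Y" for x
      using hyperplane_ext_infdist_tendsto[OF Y(1) that l _ tendsto_const norming, of sequentially]
      by (simp add: C_def tendsto_const_iff)
    then have "wijsman_converges Y (\<lambda>n. C (\<phi> n)) (C l) sequentially"
      using hyperplane_ext_infdist_tendsto[OF Y(1) _ l lim norm norming]
      by (simp add: wijsman_converges_def C_def)
    then have slice: "slice_converges Y (\<lambda>n. C (\<phi> n)) (C l) sequentially"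
      using coincide[OF Y, unfolded wijsman_slice_coincide_seq_def, rule_format,
          of "\<lambda>n. C (\<phi> n)" "C l"] level by (simp add: C_def)
    obtain u\<^sub>0 where u0: "u\<^sub>0 \<in> Y" "0 < blinfun_apply l u\<^sub>0" using norming[OF l] by blast
    define u where "u = u\<^sub>0 /\<^sub>R blinfun_apply l u\<^sub>0"
    have u: "u \<in> Y" "blinfun_apply l u = 1"
      using u0 Y(1) by (auto simp: u_def blinfun.scaleR_right subspace_scale)
    \<comment> \<open>Bounds \<open>norm w / t\<close> for the vectors used below, where
      \<open>norm w \<le> 1 + norm l * norm u\<close> and \<open>t > \<delta> / 2\<close>.\<close>
    define R where "R = (1 + norm l * norm u) * (2 / \<delta>)"
    define W where "W = {x\<in>Y. blinfun_apply l x = 0} \<inter> cball 0 R"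
    have W: "closed_convex_in Y W" "bounded W"
      using level[of l 0] by (auto simp: closed_convex_in_def W_def intro: convex_Int bounded_Int)
    have "ereal (1 / norm l) \<le> ext_setdist W (C l)"
      unfolding le_ext_setdist_iff
    proof (intro ballI)
      fix w c assume "w \<in> W" "c \<in> C l"
      then have "\<bar>blinfun_apply l (w - c)\<bar> = 1" by (simp add: W_def C_def blinfun.diff_right)
      with abs_blinfun_le[OF order_refl, of l "w - c"] l
      show "ereal (1 / norm l) \<le> ereal (norm (w - c))" by (simp add: field_simps)
    qed
    moreover have "(0::ereal) < ereal (1 / norm l)" using l by simp
    ultimately have "0 < ext_setdist W (C l)" by (rule less_le_trans[rotated])
    moreover have "(\<lambda>n. ext_setdist W (C (\<phi> n))) \<longlonglongrightarrow> ext_setdist W (C l)"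
      using slice W by (simp add: slice_converges_def)
    ultimately have "eventually (\<lambda>n. 0 < ext_setdist W (C (\<phi> n))) sequentially"
      by (intro order_tendstoD(1))
    moreover have "eventually (\<lambda>n. norm l * \<bar>blinfun_apply (\<phi> n) u - 1\<bar> < \<delta> / 2) sequentially"
    proof -
      have "(\<lambda>n. norm l * \<bar>blinfun_apply (\<phi> n) u - 1\<bar>) \<longlonglongrightarrow> norm l * \<bar>1 - 1\<bar>"
        using lim[OF u(1)] u(2) by (intro tendsto_intros) simp
      then show ?thesis using \<delta> by (intro order_tendstoD(2)) auto
    qed
    ultimately have "eventually (\<lambda>n. False) sequentially"
    proof eventually_elim
      case (elim n)
      \<comment> \<open>The projection of \<open>y n\<close> to the kernel of \<open>l\<close> along
        \<open>u\<close>; a multiple of it will lie in both \<open>W\<close> and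
        \<open>C (\<phi> n)\<close>, so that their distance vanishes.\<close>
      define w where "w = y n - blinfun_apply l (y n) *\<^sub>R u"
      define t where "t = blinfun_apply (\<phi> n) w"
      have ly: "\<bar>blinfun_apply l (y n)\<bar> \<le> norm l"
        using norm_blinfun[of l "y n"] mult_left_mono[OF y(2)[of n] norm_ge_zero[of l]] by simp
      have w: "w \<in> Y" "blinfun_apply l w = 0"
        using y(1) u Y(1)
        by (auto simp: w_def subspace_diff subspace_scale blinfun.diff_right blinfun.scaleR_right)
      have "norm w \<le> norm (y n) + \<bar>blinfun_apply l (y n)\<bar> * norm u"
        unfolding w_def using norm_triangle_ineq4[of "y n" "blinfun_apply l (y n) *\<^sub>R u"] by simp
      also have "\<dots> \<le> 1 + norm l * norm u"
        using y(2) ly by (intro add_mono mult_right_mono) auto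
      finally have norm_w: "norm w \<le> 1 + norm l * norm u" .
      \<comment> \<open>The first difference exceeds \<open>\<delta>\<close>, while the correction
        is less than \<open>\<delta> / 2\<close> because \<open>\<phi> n u\<close> is close to
        \<open>l u = 1\<close>.\<close>
      have "t = (blinfun_apply (\<phi> n) (y n) - blinfun_apply l (y n))
          - blinfun_apply l (y n) * (blinfun_apply (\<phi> n) u - 1)"
        by (simp add: t_def w_def blinfun.diff_right blinfun.scaleR_right right_diff_distrib)
      moreover have "\<bar>blinfun_apply l (y n) * (blinfun_apply (\<phi> n) u - 1)\<bar>
          \<le> norm l * \<bar>blinfun_apply (\<phi> n) u - 1\<bar>"
        unfolding abs_mult using ly by (intro mult_right_mono) auto
      ultimately have t: "\<delta> / 2 < t"
        using elim(2) y(3)[of n] by linarith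
      have "norm (w /\<^sub>R t) = norm w * (1 / t)"
        using t \<delta> by (simp add: field_simps)
      also have "\<dots> \<le> (1 + norm l * norm u) * (2 / \<delta>)"
      proof (rule mult_mono[OF norm_w])
        show "1 / t \<le> 2 / \<delta>" using t \<delta> by (simp add: field_simps)
      qed (use t \<delta> in auto)
      finally have "w /\<^sub>R t \<in> W"
        using w Y(1) by (simp add: W_def R_def subspace_scale blinfun.scaleR_right)
      moreover have "w /\<^sub>R t \<in> C (\<phi> n)"
        using w(1) Y(1) t \<delta> unfolding C_def by (auto simp: subspace_scale blinfun.scaleR_right t_def[symmetric])
      ultimately have "ext_setdist W (C (\<phi> n)) \<le> ereal (norm (w /\<^sub>R t - w /\<^sub>R t))"
        using le_ext_setdist_iff[of "ext_setdist W (C (\<phi> n))" W "C (\<phi> n)"] by blast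
      with elim(1) show False by (simp add: zero_ereal_def)
    qed
    then show False by simp
  qed
qed

theorem theorem3p2:
  assumes infinite_dim: "\<nexists>B :: 'a::banach set. finite B \<and> span B = UNIV"
  shows
    "(dual_norm_weak_star_kadec TYPE('a)
      \<longleftrightarrow>
      (\<forall>Y :: 'a set. subspace Y \<and> closed Y \<and> separable_space (top_of_set Y) \<longrightarrow>
        wijsman_slice_coincide_seq Y))
     \<and>
     ((\<forall>Y :: 'a set. subspace Y \<and> closed Y \<and> separable_space (top_of_set Y) \<longrightarrow>
        wijsman_slice_coincide_seq Y)
      \<longleftrightarrow>
      (\<forall>Y :: 'a set. subspace Y \<and> closed Y \<longrightarrow> wijsman_slice_coincide_net Y))"
  using wijsman_slice_coincide_net_if_kadec wijsman_slice_coincide_seq_if_net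
    kadec_if_wijsman_slice_coincide_seq
  by metis

end
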